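(* For every fixed positive integer $p$, there is a polynomial-time algorithm which, given a flow network ${\cal N}=(D,s,t,c)$, outputs an $(s,t)$-flow that can be decomposed into at most $p$ path-flows and whose value is at least $\frac{1}{H(p)}$ times the maximum value of an $(s,t)$-flow on ${\cal N}$ decomposable into at most $p$ path-flows, where $H(p)=\sum_{i=1}^p\frac{1}{i}$.
   Context: A flow network ${\cal N}=(D,s,t,c)$ consists of a digraph $D$, a source $s$, a sink $t$ and non-negative integer arc capacities $c$. All flows are integer valued: an $(s,t)$-flow $x$ assigns to each arc $uv$ an integer $0\le x(uv)\le c(uv)$ with flow conservation at every vertex other than $s,t$; its value is the net amount leaving $s$. A path-flow along a directed $(s,t)$-path $P$ is a flow with $x(uv)=r$ on all arcs of $P$ (for some integer $r$) and $0$ elsewhere; a flow is decomposed into path-flows if it is their arc-wise sum. *)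

theory Defs
  imports
    "Graph_Theory.Graph_Theory"
    "HOL-Analysis.Harmonic_Numbers"
    "HOL-Computational_Algebra.Polynomial"
    "HOL-Library.Log_Nat"
begin

section \<open>Flow networks\<close>

record 'v flow_network =
  net_graph :: "'v pair_pre_digraph"
  net_source :: 'v
  net_sink :: 'v
  net_cap :: "'v \<times> 'v \<Rightarrow> nat"

text \<open>As in Graph Theory's \<open>pair_digraph\<close>, digraphs are finite, without loops and
  without parallel arcs.\<close>

definition flow_network :: "'v flow_network \<Rightarrow> bool" where
  "flow_network N \<longleftrightarrow> pair_digraph (net_graph N) \<and>
     net_source N \<in> pverts (net_graph N) \<and> net_sink N \<in> pverts (net_graph N) \<and>
     net_source N \<noteq> net_sink N"

text \<open>Only the values on arcs of the network are meaningful for capacities and flows; they are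
  arbitrary, and never looked at, on all other pairs.\<close>

definition net_out :: "'v flow_network \<Rightarrow> ('v \<times> 'v \<Rightarrow> int) \<Rightarrow> 'v \<Rightarrow> int" where
  "net_out N x v =
     (\<Sum>a\<in>out_arcs (net_graph N) v. x a) - (\<Sum>a\<in>in_arcs (net_graph N) v. x a)"

definition is_flow :: "'v flow_network \<Rightarrow> ('v \<times> 'v \<Rightarrow> int) \<Rightarrow> bool" where
  "is_flow N x \<longleftrightarrow>
     (\<forall>a\<in>parcs (net_graph N). 0 \<le> x a \<and> x a \<le> int (net_cap N a)) \<and>
     (\<forall>v\<in>pverts (net_graph N) - {net_source N, net_sink N}. net_out N x v = 0)"

definition flow_value :: "'v flow_network \<Rightarrow> ('v \<times> 'v \<Rightarrow> int) \<Rightarrow> int" where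
  "flow_value N x = net_out N x (net_source N)"

definition is_path_flow :: "'v flow_network \<Rightarrow> ('v \<times> 'v \<Rightarrow> int) \<Rightarrow> bool" where
  "is_path_flow N x \<longleftrightarrow> is_flow N x \<and>
     (\<exists>P r. pre_digraph.apath (net_graph N) (net_source N) P (net_sink N) \<and>
        (\<forall>a\<in>parcs (net_graph N). x a = (if a \<in> set P then r else 0)))"

text \<open>The list of path-flows may be empty, so the zero flow is decomposable even if the sink is
  not reachable from the source.\<close>

definition decomposable :: "nat \<Rightarrow> 'v flow_network \<Rightarrow> ('v \<times> 'v \<Rightarrow> int) \<Rightarrow> bool" where
  "decomposable p N x \<longleftrightarrow>
     (\<exists>fs. length fs \<le> p \<and> (\<forall>f\<in>set fs. is_path_flow N f) \<and>
        (\<forall>a\<in>parcs (net_graph N). x a = (\<Sum>f\<leftarrow>fs. f a)))"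

definition decomposable_values :: "nat \<Rightarrow> 'v flow_network \<Rightarrow> int set" where
  "decomposable_values p N = {flow_value N x | x. is_flow N x \<and> decomposable p N x}"

definition max_decomposable_value :: "nat \<Rightarrow> 'v flow_network \<Rightarrow> int" where
  "max_decomposable_value p N = Max (decomposable_values p N)"

text \<open>The maximum is taken over a finite nonempty set.\<close>

lemma finite_decomposable_values:
  assumes "flow_network N"
  shows "finite (decomposable_values p N)"
proof -
  let ?A = "out_arcs (net_graph N) (net_source N)" and ?B = "in_arcs (net_graph N) (net_source N)"
  have sub: "?A \<subseteq> parcs (net_graph N)" "?B \<subseteq> parcs (net_graph N)"
    by (auto simp: out_arcs_def in_arcs_def)
  have "flow_value N x \<in> {- (\<Sum>a\<in>?B. int (net_cap N a)) .. (\<Sum>a\<in>?A. int (net_cap N a))}"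
    if x: "is_flow N x" for x
  proof -
    have "0 \<le> (\<Sum>a\<in>?A. x a)" "0 \<le> (\<Sum>a\<in>?B. x a)"
      using x sub by (auto intro!: sum_nonneg simp: is_flow_def)
    moreover have "(\<Sum>a\<in>?A. x a) \<le> (\<Sum>a\<in>?A. int (net_cap N a))"
      "(\<Sum>a\<in>?B. x a) \<le> (\<Sum>a\<in>?B. int (net_cap N a))"
      using x sub by (auto intro!: sum_mono simp: is_flow_def)
    ultimately show ?thesis
      by (simp add: flow_value_def net_out_def)
  qed
  then have "decomposable_values p N \<subseteq>
      {- (\<Sum>a\<in>?B. int (net_cap N a)) .. (\<Sum>a\<in>?A. int (net_cap N a))}"
    by (auto simp: decomposable_values_def)
  then show ?thesis
    by (rule finite_subset) simp
qed

lemma decomposable_values_nonempty: "decomposable_values p N \<noteq> {}"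
proof -
  have "is_flow N (\<lambda>_. 0)" "decomposable p N (\<lambda>_. 0)"
    by (auto simp: is_flow_def net_out_def decomposable_def intro: exI[of _ "[]"])
  then show ?thesis
    by (auto simp: decomposable_values_def)
qed


section \<open>Algorithms and their running time\<close>

text \<open>The machine model is a random access machine over the natural numbers under the logarithmic
  cost criterion, programmed by structured programs. The memory consists of arrays of unbounded
  length; a program can refer to finitely many of them (by constant indices), and a
  variable is an array of which only cell \<open>0\<close> is used. Each operation is charged the number of
  bits of its result (the operands and addresses are charged where they are computed), so
  a run of cost \<open>T\<close> can be simulated by a Turing machine in time polynomial in \<open>T\<close> and the number
  of bits of the input.\<close>

type_synonym memory = "nat \<Rightarrow> nat \<Rightarrow> nat"

datatype expr =
    Const nat
  | Cell nat expr
  | Plus expr expr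
  | Monus expr expr
  | Times expr expr
  | Div expr expr

primrec eval_expr :: "expr \<Rightarrow> memory \<Rightarrow> nat" where
  "eval_expr (Const n) m = n"
| "eval_expr (Cell a e) m = m a (eval_expr e m)"
| "eval_expr (Plus e f) m = eval_expr e m + eval_expr f m"
| "eval_expr (Monus e f) m = eval_expr e m - eval_expr f m"
| "eval_expr (Times e f) m = eval_expr e m * eval_expr f m"
| "eval_expr (Div e f) m = eval_expr e m div eval_expr f m"

definition nat_size :: "nat \<Rightarrow> nat" where
  "nat_size n = 1 + floorlog 2 n"

primrec expr_cost :: "expr \<Rightarrow> memory \<Rightarrow> nat" where
  "expr_cost (Const n) m = nat_size n"
| "expr_cost (Cell a e) m = nat_size (eval_expr (Cell a e) m) + expr_cost e m"
| "expr_cost (Plus e f) m = nat_size (eval_expr (Plus e f) m) + expr_cost e m + expr_cost f m"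
| "expr_cost (Monus e f) m = nat_size (eval_expr (Monus e f) m) + expr_cost e m + expr_cost f m"
| "expr_cost (Times e f) m = nat_size (eval_expr (Times e f) m) + expr_cost e m + expr_cost f m"
| "expr_cost (Div e f) m = nat_size (eval_expr (Div e f) m) + expr_cost e m + expr_cost f m"

text \<open>\<open>Assign a e f\<close> writes the value of \<open>f\<close> to the cell of array \<open>a\<close> whose index is the value
  of \<open>e\<close>. Conditions of \<open>Cond\<close> and \<open>While\<close> hold iff they are nonzero.\<close>

datatype program =
    Skip
  | Assign nat expr expr
  | Seq program program
  | Cond expr program program
  | While expr program

text \<open>\<open>exec P m T m'\<close>: started in memory \<open>m\<close>, the program \<open>P\<close> halts with memory \<open>m'\<close> at cost \<open>T\<close>.\<close>

inductive exec :: "program \<Rightarrow> memory \<Rightarrow> nat \<Rightarrow> memory \<Rightarrow> bool" where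
  Skip: "exec Skip m 1 m"
| Assign: "exec (Assign a e f) m (1 + expr_cost e m + expr_cost f m)
     (m(a := (m a)(eval_expr e m := eval_expr f m)))"
| Seq: "exec P m T m' \<Longrightarrow> exec Q m' U m'' \<Longrightarrow> exec (Seq P Q) m (1 + T + U) m''"
| CondTrue: "eval_expr e m \<noteq> 0 \<Longrightarrow> exec P m T m' \<Longrightarrow> exec (Cond e P Q) m (1 + expr_cost e m + T) m'"
| CondFalse: "eval_expr e m = 0 \<Longrightarrow> exec Q m T m' \<Longrightarrow> exec (Cond e P Q) m (1 + expr_cost e m + T) m'"
| WhileFalse: "eval_expr e m = 0 \<Longrightarrow> exec (While e P) m (1 + expr_cost e m) m"
| WhileTrue: "eval_expr e m \<noteq> 0 \<Longrightarrow> exec P m T m' \<Longrightarrow> exec (While e P) m' U m'' \<Longrightarrow>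
     exec (While e P) m (1 + expr_cost e m + T + U) m''"

inductive_cases exec_SkipE: "exec Skip m T m'"
inductive_cases exec_AssignE: "exec (Assign a e f) m T m'"
inductive_cases exec_SeqE: "exec (Seq P Q) m T m'"
inductive_cases exec_CondE: "exec (Cond e P Q) m T m'"
inductive_cases exec_WhileE: "exec (While e P) m T m'"

lemma exec_deterministic:
  "exec P m T m' \<Longrightarrow> exec P m U m'' \<Longrightarrow> T = U \<and> m' = m''"
proof (induction arbitrary: U m'' rule: exec.induct)
  case (Skip m)
  from Skip.prems show ?case by (rule exec_SkipE) simp
next
  case (Assign a e f m)
  from Assign.prems show ?case by (rule exec_AssignE) simp
next
  case (Seq P m T m' Q V n)
  from Seq.prems show ?case
  proof (rule exec_SeqE)
    fix T' k V' assume "U = Suc (T' + V')" and run: "exec P m T' k" "exec Q k V' m''"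
    moreover have "T = T' \<and> m' = k" using run(1) by (rule Seq.IH(1))
    moreover from this run(2) have "V = V' \<and> n = m''" by (intro Seq.IH(2)) simp
    ultimately show ?thesis by simp
  qed
next
  case (CondTrue e m P T m' Q)
  from CondTrue.prems show ?case
  proof (rule exec_CondE)
    fix T' assume "U = Suc (expr_cost e m + T')" and run: "exec P m T' m''"
    moreover have "T = T' \<and> m' = m''" using run by (rule CondTrue.IH)
    ultimately show ?thesis by simp
  qed (use CondTrue.hyps in simp)
next
  case (CondFalse e m Q T m' P)
  from CondFalse.prems show ?case
  proof (rule exec_CondE)
    fix T' assume "U = Suc (expr_cost e m + T')" and run: "exec Q m T' m''"
    moreover have "T = T' \<and> m' = m''" using run by (rule CondFalse.IH)
    ultimately show ?thesis by simp
  qed (use CondFalse.hyps in simp)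
next
  case (WhileFalse e m P)
  from WhileFalse.prems show ?case
    by (rule exec_WhileE) (use WhileFalse.hyps in simp_all)
next
  case (WhileTrue e m P T m' V n)
  from WhileTrue.prems show ?case
  proof (rule exec_WhileE)
    fix T' k V'
    assume "U = Suc (expr_cost e m + T' + V')" and run: "exec P m T' k" "exec (While e P) k V' m''"
    moreover have "T = T' \<and> m' = k" using run(1) by (rule WhileTrue.IH(1))
    moreover from this run(2) have "V = V' \<and> n = m''" by (intro WhileTrue.IH(2)) simp
    ultimately show ?thesis by simp
  qed (use WhileTrue.hyps in simp)
qed

text \<open>The input is placed in array \<open>0\<close>; the output is read from array \<open>1\<close>.\<close>

definition input_memory :: "nat list \<Rightarrow> memory" where
  "input_memory xs = (\<lambda>a i. if a = 0 \<and> i < length xs then xs ! i else 0)"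

definition input_size :: "nat list \<Rightarrow> nat" where
  "input_size xs = (\<Sum>k\<leftarrow>xs. nat_size k)"


section \<open>Networks as inputs\<close>

text \<open>Vertices are named by arbitrary natural numbers. A network is given by its source and sink
  followed by a list \<open>vs\<close> of its vertices and a list \<open>as\<close> of its arcs with their capacities,
  both without repetitions, in arbitrary order, and preceded by their lengths.\<close>

definition lists_network :: "nat flow_network \<Rightarrow> nat list \<Rightarrow> (nat \<times> nat) list \<Rightarrow> bool" where
  "lists_network N vs as \<longleftrightarrow>
     distinct vs \<and> set vs = pverts (net_graph N) \<and> distinct as \<and> set as = parcs (net_graph N)"

definition encode_network :: "nat flow_network \<Rightarrow> nat list \<Rightarrow> (nat \<times> nat) list \<Rightarrow> nat list" where
  "encode_network N vs as =
     [net_source N, net_sink N, length vs] @ vs @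
     [length as] @ concat (map (\<lambda>(u, v). [u, v, net_cap N (u, v)]) as)"

text \<open>An output flow is given by its values on the arcs, in the order of the input.\<close>

definition outputs_flow :: "memory \<Rightarrow> (nat \<times> nat) list \<Rightarrow> (nat \<times> nat \<Rightarrow> int) \<Rightarrow> bool" where
  "outputs_flow m as x \<longleftrightarrow> (\<forall>i < length as. x (as ! i) = int (m 1 i))"

end

theory Submission
  imports Defs
begin

text \<open>If a flow is a sum of path-flows of values \<open>r\<^sub>1 \<ge> \<dots> \<ge> r\<^sub>p\<close>, then its first \<open>i\<close> paths can all carry
  \<open>r\<^sub>i\<close>. So if \<open>B\<close> is the best value of a flow along \<open>i \<le> p\<close> paths of equal rate, then
  \<open>r\<^sub>i \<le> B / i\<close> and the value is at most \<open>B H(p)\<close>. An optimal common rate is a capacity divided by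
  some \<open>j \<le> p\<close>, rounded down, so only polynomially many pairs of \<open>i\<close> and a rate \<open>r\<close> have to be tried.
  By max-flow min-cut, \<open>i\<close> unit paths fit into the capacities \<open>c div r\<close> iff the sink stays
  reachable after every removal of \<open>i - 1\<close> units of capacity, which is tested by brute force as \<open>p\<close>
  is constant. The paths are never computed: capacities that are minimal subject to this test
  are the sum of the paths.\<close>

section \<open>Unit path packings and small cuts\<close>

text \<open>Raising a common rate stops at an arc where the rate is the capacity divided by the
  number of paths through it; this is the origin of the candidate rates. As the program runs on a
  concrete machine and its cost has to be bounded, storing paths or residual networks would be
  awkward. Removing units in \<open>i - 1\<close> nested loops around a search by repeated passes
  takes nothing but loops over the arcs, of a depth bounded in terms of \<open>p\<close>.
  Augmentation and flow decomposition thus occur in the proof but not in the program. Cutting the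
  scaled capacities at \<open>p\<close> excludes no packing of at most \<open>p\<close> paths and
  makes \<open>p\<close> decrements per arc enough to reach a minimal choice. Minimality also
  removes stray cycles: no unit is left over beside the paths, so multiplying by the rate gives the
  output directly.\<close>

lemma path_of_rtrancl:
  assumes "(u, v) \<in> R\<^sup>*"
  obtains P where "pcas u P v" "set P \<subseteq> R" "distinct (pawalk_verts u P)"
proof -
  \<comment> \<open>With \<open>UNIV\<close> as vertex set, any relation is a well-formed digraph,
    also a residual one that contains reversed arcs.\<close>
  let ?H = "\<lparr>pverts = UNIV, parcs = R\<rparr>"
  interpret H: pair_wf_digraph ?H by unfold_locales auto
  have "(u \<rightarrow>\<^sup>*\<^bsub>with_proj ?H\<^esub> v)" using assms by (simp add: H.reachable_conv)
  then obtain P where "H.apath u P v" by (auto simp: H.reachable_apath)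
  then show thesis by (intro that) (auto simp: H.apath_def H.awalk_def)
qed

lemma distinct_arcs_if_distinct_verts: "distinct (pawalk_verts u P) \<Longrightarrow> distinct P"
proof (induction P arbitrary: u)
  case (Cons e P)
  have "fst a \<in> set (pawalk_verts (snd e) P)" if "a \<in> set P" for a
    using that by (induction P arbitrary: e) auto
  with Cons show ?case by fastforce
qed simp

section \<open>Net outflow of walks and packings\<close>

lemma net_out_add: "net_out N (\<lambda>a. x a + y a) v = net_out N x v + net_out N y v"
  by (simp add: net_out_def sum.distrib)

lemma net_out_diff: "net_out N (\<lambda>a. x a - y a) v = net_out N x v - net_out N y v"
  by (simp add: net_out_def sum_subtractf)

lemma net_out_scale: "net_out N (\<lambda>a. r * x a) v = r * net_out N x v"
  by (simp add: net_out_def right_diff_distrib sum_distrib_left)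

lemma net_out_sum_list:
  "net_out N (\<lambda>a. \<Sum>f\<leftarrow>fs. g f a) v = (\<Sum>f\<leftarrow>fs. net_out N (g f) v)"
  by (induction fs) (simp_all add: net_out_add, simp add: net_out_def)

lemma net_out_cong:
  assumes "\<And>a. a \<in> parcs (net_graph N) \<Longrightarrow> x a = y a"
  shows "net_out N x v = net_out N y v"
  using assms by (auto simp: net_out_def out_arcs_def in_arcs_def intro!: arg_cong2[of _ _ _ _ "(-)"] sum.cong)

text \<open>The contributions of consecutive arcs telescope. What \<open>e\<close> contributes is
  left abstract as \<open>g e\<close>, since a step of an augmenting path may mean one unit less on
  the reversed arc.\<close>

lemma net_out_walk:
  assumes "pcas u P v"
    and "\<And>e. e \<in> set P \<Longrightarrow> net_out N (g e) z = of_bool (z = fst e) - of_bool (z = snd e)"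
  shows "net_out N (\<lambda>a. \<Sum>e\<leftarrow>P. g e a) z = of_bool (z = u) - of_bool (z = v)"
  using assms
proof (induction P arbitrary: u)
  case Nil
  then show ?case by (simp add: net_out_def)
next
  case (Cons e P)
  then show ?case by (auto simp: net_out_add)
qed

definition st_path :: "'v flow_network \<Rightarrow> ('v \<times> 'v) list \<Rightarrow> bool" where
  "st_path N P \<longleftrightarrow> pcas (net_source N) P (net_sink N) \<and> set P \<subseteq> parcs (net_graph N) \<and>
     distinct (pawalk_verts (net_source N) P)"

definition load :: "('v \<times> 'v) list list \<Rightarrow> 'v \<times> 'v \<Rightarrow> nat" where
  "load Ps a = (\<Sum>P\<leftarrow>Ps. of_bool (a \<in> set P))"

definition packs :: "'v flow_network \<Rightarrow> nat \<Rightarrow> ('v \<times> 'v \<Rightarrow> nat) \<Rightarrow> bool" where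
  "packs N n w \<longleftrightarrow> (\<exists>Ps. length Ps = n \<and> (\<forall>P\<in>set Ps. st_path N P) \<and>
     (\<forall>a\<in>parcs (net_graph N). load Ps a \<le> w a))"

definition support :: "'v flow_network \<Rightarrow> ('v \<times> 'v \<Rightarrow> nat) \<Rightarrow> ('v \<times> 'v) set" where
  "support N w = {a \<in> parcs (net_graph N). 0 < w a}"

text \<open>The sink stays reachable after the removal of any \<open>k\<close> units of capacity.\<close>

primrec feas :: "'v flow_network \<Rightarrow> nat \<Rightarrow> ('v \<times> 'v \<Rightarrow> nat) \<Rightarrow> bool" where
  "feas N 0 w \<longleftrightarrow> (net_source N, net_sink N) \<in> (support N w)\<^sup>*"
| "feas N (Suc k) w \<longleftrightarrow> (\<forall>a\<in>parcs (net_graph N). feas N k (w(a := w a - 1)))"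

lemma load_simps [simp]: "load [] a = 0" "load (P # Ps) a = of_bool (a \<in> set P) + load Ps a"
  by (simp_all add: load_def)

lemma load_le_length: "load Ps a \<le> length Ps"
  by (induction Ps) auto

lemma load_pos_iff: "0 < load Ps a \<longleftrightarrow> (\<exists>P\<in>set Ps. a \<in> set P)"
  by (induction Ps) auto

lemma load_remove1:
  assumes "P \<in> set Ps"
  shows "load Ps a = of_bool (a \<in> set P) + load (remove1 P Ps) a"
  using assms by (induction Ps) auto

locale network =
  fixes N :: "'v flow_network"
  assumes network: "flow_network N"
begin

abbreviation "A \<equiv> parcs (net_graph N)"
abbreviation "s \<equiv> net_source N"
abbreviation "t \<equiv> net_sink N"

lemma s_neq_t: "s \<noteq> t"
  using network by (simp add: flow_network_def)

lemma pair_digraph_N: "pair_digraph (net_graph N)"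
  using network by (simp add: flow_network_def)

lemma finite_A: "finite A" and finite_V: "finite (pverts (net_graph N))"
  using pair_digraph_N
  by (auto simp: pair_digraph_def pair_fin_digraph_def pair_fin_digraph_axioms_def)

lemma arc_verts: "a \<in> A \<Longrightarrow> fst a \<in> pverts (net_graph N)" "a \<in> A \<Longrightarrow> snd a \<in> pverts (net_graph N)"
  using pair_digraph_N pair_wf_digraph.arc_fst_in_verts pair_wf_digraph.arc_snd_in_verts
    pair_digraph.pair_wf_digraph by metis+

lemma out_arcs_eq: "out_arcs (net_graph N) v = {a \<in> A. fst a = v}"
  and in_arcs_eq: "in_arcs (net_graph N) v = {a \<in> A. snd a = v}"
  by (auto simp: out_arcs_def in_arcs_def)

lemma st_path_iff: "st_path N P \<longleftrightarrow> pre_digraph.apath (net_graph N) s P t"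
proof -
  have "s \<in> pverts (net_graph N)" using network by (simp add: flow_network_def)
  interpret G: pair_digraph "net_graph N" by (fact pair_digraph_N)
  show ?thesis
    using \<open>s \<in> _\<close> by (auto simp: st_path_def G.apath_def G.awalk_def)
qed

lemma net_out_arc:
  assumes "e \<in> A"
  shows "net_out N (\<lambda>a. of_bool (a = e)) z = of_bool (z = fst e) - of_bool (z = snd e)"
proof -
  have "(\<Sum>a\<in>{a \<in> A. P a}. of_bool (a = e)) = (of_bool (P e) :: int)" for P
  proof -
    have "{a \<in> A. P a} \<inter> {a. a = e} = (if P e then {e} else {})" using assms by auto
    then show ?thesis using finite_A assms by (auto simp: sum.If_cases of_bool_def split: if_splits)
  qed
  then show ?thesis by (auto simp: net_out_def out_arcs_eq in_arcs_eq)
qed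

lemma net_out_st_path:
  assumes "st_path N P"
  shows "net_out N (\<lambda>a. of_bool (a \<in> set P)) z = of_bool (z = s) - of_bool (z = t)"
proof -
  have "distinct P" using assms by (auto simp: st_path_def intro: distinct_arcs_if_distinct_verts)
  then have "of_bool (a \<in> set P) = (\<Sum>e\<leftarrow>P. of_bool (a = e) :: int)" for a
    by (induction P) (auto simp: of_bool_def)
  then have "(\<lambda>a. of_bool (a \<in> set P)) = (\<lambda>a. \<Sum>e\<leftarrow>P. of_bool (a = e) :: int)" ..
  moreover have "net_out N (\<lambda>a. \<Sum>e\<leftarrow>P. of_bool (a = e)) z = of_bool (z = s) - of_bool (z = t)"
    by (rule net_out_walk) (use assms in \<open>auto simp only: st_path_def intro!: net_out_arc\<close>)
  ultimately show ?thesis by simp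
qed

lemma net_out_load:
  assumes "\<And>P. P \<in> set Ps \<Longrightarrow> st_path N P"
  shows "net_out N (\<lambda>a. int (load Ps a)) z = int (length Ps) * (of_bool (z = s) - of_bool (z = t))"
  using assms
proof (induction Ps)
  case Nil
  then show ?case by (simp add: net_out_def)
next
  case (Cons P Ps)
  then show ?case by (simp add: net_out_add net_out_st_path algebra_simps)
qed

section \<open>Cuts, decomposition into paths and augmentation\<close>

lemma sum_net_out:
  assumes S: "S \<subseteq> pverts (net_graph N)"
  shows "(\<Sum>v\<in>S. net_out N x v) =
    (\<Sum>a\<in>{a \<in> A. fst a \<in> S \<and> snd a \<notin> S}. x a) - (\<Sum>a\<in>{a \<in> A. fst a \<notin> S \<and> snd a \<in> S}. x a)"
proof -
  have "finite S" using S finite_V finite_subset by blast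
  have *: "(\<Sum>v\<in>S. \<Sum>a\<in>{a \<in> A. h a = v}. x a) = (\<Sum>a\<in>{a \<in> A. h a \<in> S}. x a)" for h
  proof -
    have "(\<Sum>v\<in>S. \<Sum>a\<in>{a \<in> {a \<in> A. h a \<in> S}. h a = v}. x a) = (\<Sum>a\<in>{a \<in> A. h a \<in> S}. x a)"
      using finite_A \<open>finite S\<close> by (intro sum.group) auto
    moreover have "{a \<in> {a \<in> A. h a \<in> S}. h a = v} = {a \<in> A. h a = v}" if "v \<in> S" for v
      using that by auto
    ultimately show ?thesis by simp
  qed
  \<comment> \<open>Arcs with both ends in \<open>S\<close> occur once as outgoing and once as
    incoming, so they cancel.\<close>
  have "{a \<in> A. fst a \<in> S} = {a \<in> A. fst a \<in> S \<and> snd a \<notin> S} \<union> {a \<in> A. fst a \<in> S \<and> snd a \<in> S}"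
    "{a \<in> A. snd a \<in> S} = {a \<in> A. fst a \<notin> S \<and> snd a \<in> S} \<union> {a \<in> A. fst a \<in> S \<and> snd a \<in> S}"
    by auto
  moreover have "(\<Sum>a\<in>{a \<in> A. fst a \<in> S \<and> snd a \<notin> S} \<union> {a \<in> A. fst a \<in> S \<and> snd a \<in> S}. x a)
     = (\<Sum>a\<in>{a \<in> A. fst a \<in> S \<and> snd a \<notin> S}. x a) + (\<Sum>a\<in>{a \<in> A. fst a \<in> S \<and> snd a \<in> S}. x a)"
    "(\<Sum>a\<in>{a \<in> A. fst a \<notin> S \<and> snd a \<in> S} \<union> {a \<in> A. fst a \<in> S \<and> snd a \<in> S}. x a)
     = (\<Sum>a\<in>{a \<in> A. fst a \<notin> S \<and> snd a \<in> S}. x a) + (\<Sum>a\<in>{a \<in> A. fst a \<in> S \<and> snd a \<in> S}. x a)"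
    using finite_A by (auto intro!: sum.union_disjoint)
  ultimately show ?thesis
    by (simp add: net_out_def out_arcs_eq in_arcs_eq sum_subtractf *)
qed

text \<open>The net outflow is prescribed at the source and the sink as well, so its sum over any
  set of vertices that contains \<open>s\<close> but not \<open>t\<close> is \<open>n\<close>.
  Capacity bounds are stated separately where augmentation uses them.\<close>

definition st_flow :: "int \<Rightarrow> ('v \<times> 'v \<Rightarrow> int) \<Rightarrow> bool" where
  "st_flow n y \<longleftrightarrow> (\<forall>a\<in>A. 0 \<le> y a) \<and>
     (\<forall>v\<in>pverts (net_graph N). net_out N y v = n * (of_bool (v = s) - of_bool (v = t)))"

lemma st_flow_cut:
  assumes "st_flow n y" "S \<subseteq> pverts (net_graph N)" "s \<in> S" "t \<notin> S"
  shows "n = (\<Sum>a\<in>{a \<in> A. fst a \<in> S \<and> snd a \<notin> S}. y a) -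
    (\<Sum>a\<in>{a \<in> A. fst a \<notin> S \<and> snd a \<in> S}. y a)"
proof -
  have "finite S" using assms finite_V finite_subset by blast
  have "(\<Sum>v\<in>S. net_out N y v) = (\<Sum>v\<in>S. if v = s then n else 0)"
    using assms by (intro sum.cong) (auto simp: st_flow_def subset_iff)
  also have "\<dots> = n" using assms \<open>finite S\<close> by simp
  finally show ?thesis using sum_net_out[OF assms(2)] by simp
qed

lemma rtrancl_verts:
  assumes "(u, v) \<in> R\<^sup>*" "u \<in> pverts (net_graph N)" "R \<subseteq> pverts (net_graph N) \<times> pverts (net_graph N)"
  shows "v \<in> pverts (net_graph N)"
  using assms by (induction) auto

lemma s_in_V: "s \<in> pverts (net_graph N)"
  using network by (simp add: flow_network_def)

text \<open>While the value is positive, arcs with positive flow lead from \<open>s\<close> to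
  \<open>t\<close>: otherwise the vertices reached would form a cut that no flow leaves. Peeling off
  a unit along a path lowers the value by one. Cycles of the flow may be left over, so
  \<open>y\<close> only bounds the loads.\<close>

lemma st_flow_packs:
  assumes "st_flow (int n) y"
  shows "packs N n (\<lambda>a. nat (y a))"
  using assms
proof (induction n arbitrary: y)
  case 0
  then show ?case by (auto simp: packs_def)
next
  case (Suc n)
  let ?R = "{a \<in> A. 0 < y a}"
  define S where "S = {v. (s, v) \<in> ?R\<^sup>*}"
  have "t \<in> S"
  proof (rule ccontr)
    assume "t \<notin> S"
    moreover have "?R \<subseteq> pverts (net_graph N) \<times> pverts (net_graph N)"
      using arc_verts by fastforce
    then have "S \<subseteq> pverts (net_graph N)" using rtrancl_verts s_in_V by (auto simp: S_def)
    moreover have "s \<in> S" by (simp add: S_def)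
    ultimately have "int (Suc n) = (\<Sum>a\<in>{a \<in> A. fst a \<in> S \<and> snd a \<notin> S}. y a) -
      (\<Sum>a\<in>{a \<in> A. fst a \<notin> S \<and> snd a \<in> S}. y a)"
      using st_flow_cut[OF Suc.prems, of S] by blast
    moreover have "(\<Sum>a\<in>{a \<in> A. fst a \<in> S \<and> snd a \<notin> S}. y a) \<le> 0"
    proof (rule sum_nonpos)
      fix a assume a: "a \<in> {a \<in> A. fst a \<in> S \<and> snd a \<notin> S}"
      show "y a \<le> 0"
      proof (rule ccontr)
        assume "\<not> y a \<le> 0"
        then have "(fst a, snd a) \<in> ?R" using a by auto
        with a show False by (auto simp: S_def intro: rtrancl_into_rtrancl)
      qed
    qed
    moreover have "0 \<le> (\<Sum>a\<in>{a \<in> A. fst a \<notin> S \<and> snd a \<in> S}. y a)"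
      using Suc.prems by (intro sum_nonneg) (auto simp: st_flow_def)
    ultimately show False by simp
  qed
  then have "(s, t) \<in> ?R\<^sup>*" by (simp add: S_def)
  then obtain P where P: "pcas s P t" "set P \<subseteq> ?R" "distinct (pawalk_verts s P)"
    by (rule path_of_rtrancl)
  then have path: "st_path N P" by (auto simp: st_path_def)
  let ?y = "\<lambda>a. y a - of_bool (a \<in> set P)"
  have "st_flow (int n) ?y"
    unfolding st_flow_def
  proof (intro conjI ballI)
    fix a assume "a \<in> A"
    with Suc.prems P(2) show "0 \<le> ?y a" by (auto simp: st_flow_def of_bool_def)
  next
    fix v assume "v \<in> pverts (net_graph N)"
    with Suc.prems have "net_out N y v = (int n + 1) * (of_bool (v = s) - of_bool (v = t))"
      by (simp add: st_flow_def)
    then show "net_out N ?y v = int n * (of_bool (v = s) - of_bool (v = t))"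
      by (simp only: net_out_diff net_out_st_path[OF path] distrib_right) simp
  qed
  then have "packs N n (\<lambda>a. nat (?y a))" by (rule Suc.IH)
  then obtain Ps where Ps: "length Ps = n" "\<forall>P\<in>set Ps. st_path N P" "\<forall>a\<in>A. load Ps a \<le> nat (?y a)"
    by (auto simp: packs_def)
  have "load (P # Ps) a \<le> nat (y a)" if "a \<in> A" for a
    using that Ps(3) P(2) by (force simp: of_bool_def split: if_splits)
  with Ps path show ?case
    unfolding packs_def by (intro exI[of _ "P # Ps"]) auto
qed

text \<open>Each removal can be spent on an arc of the cut, which lowers its capacity by one, and
  the cut that remains must still be crossed.\<close>

lemma feas_cut:
  assumes "feas N k w" "s \<in> S" "t \<notin> S" "A \<noteq> {}"
  shows "k < (\<Sum>a\<in>{a \<in> A. fst a \<in> S \<and> snd a \<notin> S}. w a)"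
  using assms(1)
proof (induction k arbitrary: w)
  case 0
  have "\<exists>a\<in>A. fst a \<in> S \<and> snd a \<notin> S \<and> 0 < w a"
  proof (rule ccontr)
    assume no: "\<not> ?thesis"
    have "(s, t) \<in> (support N w)\<^sup>*" using 0 by simp
    then have "t \<in> S"
    proof (induction rule: rtrancl_induct)
      case (step u v)
      then have "(u, v) \<in> A" "0 < w (u, v)" by (simp_all add: support_def)
      then have "\<not> (fst (u, v) \<in> S \<and> snd (u, v) \<notin> S \<and> 0 < w (u, v))" using no by blast
      with \<open>0 < w (u, v)\<close> step.IH show ?case by simp
    qed (fact assms)
    with assms show False by simp
  qed
  then obtain a where "a \<in> {a \<in> A. fst a \<in> S \<and> snd a \<notin> S}" "0 < w a" by blast
  then show ?case
    using finite_A by (intro sum_pos2) auto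
next
  case (Suc k)
  let ?C = "{a \<in> A. fst a \<in> S \<and> snd a \<notin> S}"
  have fin: "finite ?C" using finite_A by simp
  show ?case
  proof (cases "\<exists>a\<in>?C. 0 < w a")
    case True
    then obtain a where a: "a \<in> ?C" "0 < w a" by blast
    then have "feas N k (w(a := w a - 1))" using Suc.prems by simp
    then have "k < (\<Sum>b\<in>?C. (w(a := w a - 1)) b)" by (rule Suc.IH)
    also have "\<dots> = (w a - 1) + (\<Sum>b\<in>?C - {a}. (w(a := w a - 1)) b)"
      using sum.remove[OF fin a(1), of "w(a := w a - 1)"] by (simp only: fun_upd_same)
    also have "(\<Sum>b\<in>?C - {a}. (w(a := w a - 1)) b) = (\<Sum>b\<in>?C - {a}. w b)"
      by (rule sum.cong) auto
    finally show ?thesis using sum.remove[OF fin a(1), of w] a(2) by linarith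
  next
    case False
    \<comment> \<open>The cut has no capacity, so the induction hypothesis after a removal at an
      arbitrary arc yields \<open>k < 0\<close>.\<close>
    obtain a where "a \<in> A" using assms by blast
    then have "feas N k (w(a := w a - 1))" using Suc.prems by simp
    then have "k < (\<Sum>b\<in>?C. (w(a := w a - 1)) b)" by (rule Suc.IH)
    moreover have "(\<Sum>b\<in>?C. (w(a := w a - 1)) b) = 0"
    proof (intro sum.neutral ballI)
      fix b assume b: "b \<in> ?C"
      have "\<not> 0 < w b"
      proof
        assume "0 < w b"
        then have "\<exists>a\<in>?C. 0 < w a" using b by (rule bexI)
        with False show False by contradiction
      qed
      then show "(w(a := w a - 1)) b = 0" by (cases "b = a") simp_all
    qed
    ultimately show ?thesis by simp
  qed
qed

definition residual :: "('v \<times> 'v \<Rightarrow> nat) \<Rightarrow> ('v \<times> 'v \<Rightarrow> int) \<Rightarrow> ('v \<times> 'v) set" where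
  "residual w y = {a \<in> A. y a < int (w a)} \<union> {e. prod.swap e \<in> A \<and> 0 < y (prod.swap e)}"

lemma augment:
  assumes flow: "st_flow n y" and cap: "\<forall>a\<in>A. y a \<le> int (w a)"
    and reach: "(s, t) \<in> (residual w y)\<^sup>*"
  shows "\<exists>y'. st_flow (n + 1) y' \<and> (\<forall>a\<in>A. y' a \<le> int (w a))"
proof -
  obtain P where P: "pcas s P t" "set P \<subseteq> residual w y" "distinct (pawalk_verts s P)"
    using path_of_rtrancl[OF reach] .
  \<comment> \<open>If \<open>e\<close> and its reverse are both arcs, \<open>e\<close> can be
    residual for two reasons: spare capacity on \<open>e\<close>, or flow to cancel on the reverse.
    The first is preferred, so that each step of \<open>P\<close> changes exactly one arc by one
    unit.\<close>
  define fwd where "fwd e \<longleftrightarrow> e \<in> A \<and> y e < int (w e)" for e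
  define g where "g e a = (if fwd e then of_bool (a = e) else - of_bool (a = prod.swap e) :: int)" for e a
  let ?d = "\<lambda>a. \<Sum>e\<leftarrow>P. g e a"
  have "distinct P" using P(3) by (rule distinct_arcs_if_distinct_verts)
  then have count: "(\<Sum>e\<leftarrow>P. of_bool (e = b \<and> Q)) = (of_bool (b \<in> set P \<and> Q) :: int)" for b Q
    by (induction P) (auto simp: of_bool_def)
  have "g e a = of_bool (e = a \<and> fwd a) - of_bool (e = prod.swap a \<and> \<not> fwd (prod.swap a))" for e a
  proof (cases "fwd e")
    case True
    then have "(e = a \<and> fwd a) = (a = e)" "\<not> (e = prod.swap a \<and> \<not> fwd (prod.swap a))" by metis+
    with True show ?thesis by (simp only: g_def if_True) simp
  next
    case False
    then have "(e = prod.swap a \<and> \<not> fwd (prod.swap a)) = (a = prod.swap e)" "\<not> (e = a \<and> fwd a)"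
      by (metis swap_swap)+
    with False show ?thesis by (simp only: g_def if_False) simp
  qed
  \<comment> \<open>Since \<open>P\<close> repeats no arc, an arc gains at most one unit, from its
    own forward step, and loses at most one, from a backward step along its reverse.\<close>
  then have d: "?d a = of_bool (a \<in> set P \<and> fwd a) -
      of_bool (prod.swap a \<in> set P \<and> \<not> fwd (prod.swap a))" for a
    by (simp only: sum_list_subtractf count)
  have rev_arc: "prod.swap e \<in> A \<and> 0 < y (prod.swap e)" if "e \<in> set P" "\<not> fwd e" for e
    using subsetD[OF P(2) that(1)] that(2) by (simp add: residual_def fwd_def) blast
  have net_d: "net_out N ?d z = of_bool (z = s) - of_bool (z = t)" for z
  proof (rule net_out_walk[OF P(1)])
    fix e assume e: "e \<in> set P"
    show "net_out N (g e) z = of_bool (z = fst e) - of_bool (z = snd e)"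
    proof (cases "fwd e")
      case True
      then show ?thesis using net_out_arc[of e z] by (simp add: g_def[abs_def] fwd_def)
    next
      case False
      then have "g e = (\<lambda>a. (-1) * of_bool (a = prod.swap e))" by (simp add: g_def fun_eq_iff)
      moreover have "prod.swap e \<in> A" using rev_arc[OF e False] by simp
      ultimately show ?thesis using net_out_arc[of "prod.swap e" z]
        by (simp only: net_out_scale) simp
    qed
  qed
  have "st_flow (n + 1) (\<lambda>a. y a + ?d a)"
    unfolding st_flow_def
  proof (intro conjI ballI)
    fix a assume "a \<in> A"
    then have "0 \<le> y a" using flow by (simp add: st_flow_def)
    with rev_arc[of "prod.swap a"] show "0 \<le> y a + ?d a"
      unfolding d by (simp add: of_bool_def split: if_splits)
  next
    fix v assume "v \<in> pverts (net_graph N)"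
    with flow have "net_out N y v = n * (of_bool (v = s) - of_bool (v = t))"
      by (simp add: st_flow_def)
    then show "net_out N (\<lambda>a. y a + ?d a) v = (n + 1) * (of_bool (v = s) - of_bool (v = t))"
      by (simp only: net_out_add net_d distrib_right) simp
  qed
  moreover have "y a + ?d a \<le> int (w a)" if "a \<in> A" for a
    using bspec[OF cap that] unfolding d by (simp add: of_bool_def fwd_def)
  ultimately show ?thesis by blast
qed

text \<open>Without an augmenting path, the vertices reachable in the residual relation form a cut
  whose outgoing arcs are saturated and whose incoming arcs are empty. Its capacity is then the
  current value, which is at most \<open>k\<close>, against \<open>feas_cut\<close>.\<close>

lemma feas_st_flow:
  assumes "feas N k w" "A \<noteq> {}" "n \<le> Suc k"
  shows "\<exists>y. st_flow (int n) y \<and> (\<forall>a\<in>A. y a \<le> int (w a))"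
  using assms(3)
proof (induction n)
  case 0
  show ?case by (intro exI[of _ "\<lambda>_. 0"]) (simp add: st_flow_def net_out_def)
next
  case (Suc n)
  then obtain y where y: "st_flow (int n) y" "\<forall>a\<in>A. y a \<le> int (w a)" by auto
  define S where "S = {v. (s, v) \<in> (residual w y)\<^sup>*}"
  have "s \<in> S" by (simp add: S_def)
  have step: "snd a \<in> S" if "fst a \<in> S" "a \<in> residual w y" for a
    using that by (cases a) (auto simp: S_def intro: rtrancl_into_rtrancl)
  have "t \<in> S"
  proof (rule ccontr)
    assume "t \<notin> S"
    moreover have "residual w y \<subseteq> pverts (net_graph N) \<times> pverts (net_graph N)"
      using arc_verts by (fastforce simp: residual_def)
    then have "S \<subseteq> pverts (net_graph N)" using rtrancl_verts s_in_V by (auto simp: S_def)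
    ultimately have "int n = (\<Sum>a\<in>{a \<in> A. fst a \<in> S \<and> snd a \<notin> S}. y a) -
      (\<Sum>a\<in>{a \<in> A. fst a \<notin> S \<and> snd a \<in> S}. y a)"
      using st_flow_cut[OF y(1), of S] \<open>s \<in> S\<close> by blast
    moreover have "(\<Sum>a\<in>{a \<in> A. fst a \<in> S \<and> snd a \<notin> S}. y a) =
        (\<Sum>a\<in>{a \<in> A. fst a \<in> S \<and> snd a \<notin> S}. int (w a))"
    proof (rule sum.cong[OF refl])
      fix a assume a: "a \<in> {a \<in> A. fst a \<in> S \<and> snd a \<notin> S}"
      then have "a \<notin> residual w y" using step by blast
      with a y(2) show "y a = int (w a)" by (fastforce simp: residual_def)
    qed
    moreover have "(\<Sum>a\<in>{a \<in> A. fst a \<notin> S \<and> snd a \<in> S}. y a) = 0"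
    proof (rule sum.neutral, rule ballI)
      fix a assume a: "a \<in> {a \<in> A. fst a \<notin> S \<and> snd a \<in> S}"
      then have "(snd a, fst a) \<notin> residual w y" using step[of "(snd a, fst a)"] by auto
      with a y(1) show "y a = 0" by (force simp: residual_def st_flow_def)
    qed
    moreover have "k < (\<Sum>a\<in>{a \<in> A. fst a \<in> S \<and> snd a \<notin> S}. w a)"
      using feas_cut[OF assms(1), of S] \<open>s \<in> S\<close> \<open>t \<notin> S\<close> assms(2) by simp
    then have "int k < (\<Sum>a\<in>{a \<in> A. fst a \<in> S \<and> snd a \<notin> S}. int (w a))"
      by (simp only: of_nat_sum[symmetric] of_nat_less_iff)
    ultimately show False using Suc.prems by simp
  qed
  then have "(s, t) \<in> (residual w y)\<^sup>*" by (simp add: S_def)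
  then show ?case using augment[OF y] by (simp add: add.commute)
qed

text \<open>One path is given up per removal, and the last one still connects \<open>s\<close> to
  \<open>t\<close>.\<close>

lemma packs_feas: "packs N (Suc k) w \<Longrightarrow> feas N k w"
proof (induction k arbitrary: w)
  case 0
  then obtain P where P: "st_path N P" "\<forall>a\<in>A. load [P] a \<le> w a"
    by (auto simp: packs_def length_Suc_conv)
  then have "set P \<subseteq> support N w"
    by (force simp: support_def st_path_def)
  moreover have "pcas u P v \<Longrightarrow> set P \<subseteq> R \<Longrightarrow> (u, v) \<in> R\<^sup>*" for u v R
    by (induction P arbitrary: u) (auto intro: converse_rtrancl_into_rtrancl)
  ultimately show ?case using P(1) by (auto simp: st_path_def)
next
  case (Suc k)
  then obtain Ps where Ps: "length Ps = Suc (Suc k)" "\<forall>P\<in>set Ps. st_path N P" "\<forall>a\<in>A. load Ps a \<le> w a"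
    by (auto simp: packs_def)
  have "packs N (Suc k) (w(a := w a - 1))" if "a \<in> A" for a
  proof -
    \<comment> \<open>The path to give up: one through \<open>a\<close>, or any path if none uses
      \<open>a\<close>.\<close>
    obtain P where P: "P \<in> set Ps" "a \<in> set P \<or> load Ps a = 0"
      using load_pos_iff[of Ps a] Ps(1) by (metis gr0I length_0_conv list.set_intros(1) nat.distinct(1) neq_Nil_conv)
    have "load (remove1 P Ps) b \<le> (w(a := w a - 1)) b" if "b \<in> A" for b
    proof -
      have "load Ps b \<le> w b" using Ps(3) that by blast
      then show ?thesis using load_remove1[OF P(1), of b] P(2) by (auto simp: of_bool_def split: if_splits)
    qed
    moreover have "length (remove1 P Ps) = Suc k" using P(1) Ps(1) by (simp add: length_remove1)
    moreover have "\<forall>P'\<in>set (remove1 P Ps). st_path N P'" using Ps(2) by (meson notin_set_remove1)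
    ultimately show ?thesis unfolding packs_def by blast
  qed
  then have "\<forall>a\<in>A. feas N k (w(a := w a - 1))" using Suc.IH by blast
  then show ?case by simp
qed

lemma packs_mono:
  assumes "packs N n w" "\<And>a. a \<in> A \<Longrightarrow> w a \<le> w' a"
  shows "packs N n w'"
proof -
  obtain Ps where "length Ps = n" "\<forall>P\<in>set Ps. st_path N P" "\<forall>a\<in>A. load Ps a \<le> w a"
    using assms(1) by (auto simp: packs_def)
  then show ?thesis
    unfolding packs_def using assms(2) by (intro exI[of _ Ps]) (auto intro: le_trans)
qed

text \<open>An arc must exist because \<open>feas N (Suc k) w\<close> holds vacuously over an empty
  set of arcs. The index is shifted since one path must survive \<open>k\<close> removals.\<close>

lemma feas_iff_packs:
  assumes "A \<noteq> {}"
  shows "feas N k w \<longleftrightarrow> packs N (Suc k) w"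
proof
  assume "feas N k w"
  then obtain y where y: "st_flow (int (Suc k)) y" "\<forall>a\<in>A. y a \<le> int (w a)"
    using feas_st_flow[OF _ assms] by blast
  show "packs N (Suc k) w"
    by (rule packs_mono[OF st_flow_packs[OF y(1)]]) (use y(2) in \<open>simp add: nat_le_iff\<close>)
qed (rule packs_feas)

text \<open>A packing that leaves a unit of \<open>a\<close> unloaded still fits once this unit is
  removed, against minimality.\<close>

lemma packs_minimal:
  assumes "packs N n w" and min: "\<And>a. a \<in> A \<Longrightarrow> w a = 0 \<or> \<not> packs N n (w(a := w a - 1))"
  obtains Ps where "length Ps = n" "\<And>P. P \<in> set Ps \<Longrightarrow> st_path N P" "\<And>a. a \<in> A \<Longrightarrow> load Ps a = w a"
proof -
  obtain Ps where Ps: "length Ps = n" "\<forall>P\<in>set Ps. st_path N P" "\<forall>a\<in>A. load Ps a \<le> w a"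
    using assms(1) by (auto simp: packs_def)
  have "load Ps a = w a" if a: "a \<in> A" for a
  proof (rule ccontr)
    assume "load Ps a \<noteq> w a"
    then have "load Ps a < w a" using Ps(3) a by (simp add: order_le_neq_trans)
    then have "packs N n (w(a := w a - 1))" unfolding packs_def using Ps by (intro exI[of _ Ps]) auto
    with min[OF a] \<open>load Ps a < w a\<close> show False by simp
  qed
  with Ps that show thesis by blast
qed

section \<open>Equal path-flows against arbitrary ones\<close>

lemma flow_of_equal_paths:
  assumes "\<And>P. P \<in> set Ps \<Longrightarrow> st_path N P" "length Ps \<le> p"
    and cap: "\<And>a. a \<in> A \<Longrightarrow> r * load Ps a \<le> net_cap N a"
    and x: "\<And>a. a \<in> A \<Longrightarrow> x a = int (r * load Ps a)"
  shows "is_flow N x" "decomposable p N x" "flow_value N x = int (length Ps * r)"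
proof -
  have net_x: "net_out N x z = int r * (int (length Ps) * (of_bool (z = s) - of_bool (z = t)))" for z
  proof -
    have "net_out N x z = net_out N (\<lambda>a. int r * int (load Ps a)) z"
      by (rule net_out_cong) (simp add: x)
    then show ?thesis by (simp only: net_out_scale net_out_load[OF assms(1)])
  qed
  show "is_flow N x"
    using x cap by (auto simp: is_flow_def net_x simp del: of_nat_mult)
  show "flow_value N x = int (length Ps * r)"
    using s_neq_t by (simp add: flow_value_def net_x)
  have path_flow: "is_path_flow N (\<lambda>a. if a \<in> set P then int r else 0)" if P: "P \<in> set Ps" for P
  proof -
    have "(\<lambda>a. if a \<in> set P then int r else 0) = (\<lambda>a. int r * of_bool (a \<in> set P))" by auto
    then have net: "net_out N (\<lambda>a. if a \<in> set P then int r else 0) z = int r * (of_bool (z = s) - of_bool (z = t))" for z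
      using net_out_st_path[OF assms(1)[OF P]] by (simp only: net_out_scale)
    have "r \<le> net_cap N a" if "a \<in> A" "a \<in> set P" for a
    proof -
      have "0 < load Ps a" using P that load_pos_iff by blast
      then have "r * 1 \<le> r * load Ps a" by (intro mult_le_mono2) simp
      with cap[OF that(1)] show ?thesis by linarith
    qed
    then have "is_flow N (\<lambda>a. if a \<in> set P then int r else 0)"
      by (auto simp: is_flow_def net)
    with assms(1)[OF P] show ?thesis
      unfolding is_path_flow_def st_path_iff by blast
  qed
  have "int (r * load Ps a) = (\<Sum>f\<leftarrow>map (\<lambda>P a. if a \<in> set P then int r else 0) Ps. f a)" for a
    by (induction Ps) (auto simp: algebra_simps)
  with x path_flow assms(2) show "decomposable p N x"
    unfolding decomposable_def by (intro exI[of _ "map (\<lambda>P a. if a \<in> set P then int r else 0) Ps"]) auto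
qed

text \<open>In ascending order, \<open>length rs - k\<close> entries are at least
  \<open>rs ! k\<close>; this is the number of paths that can share the rate. Dividing bounds the
  entries by \<open>B / i\<close> for \<open>i = length rs, ..., 1\<close>.\<close>

lemma sorted_sum_le_harm:
  assumes "sorted rs" "\<And>k. k < length rs \<Longrightarrow> real (length rs - k) * rs ! k \<le> B"
  shows "sum_list rs \<le> B * harm (length rs)"
  using assms
proof (induction rs)
  case Nil
  then show ?case by (simp add: harm_def)
next
  case (Cons r rs)
  have "sum_list rs \<le> B * harm (length rs)"
    using Cons.prems(1) Cons.prems(2)[of "Suc _"] by (intro Cons.IH) auto
  moreover have "r \<le> B / real (Suc (length rs))"
    using Cons.prems(2)[of 0] by (simp add: field_simps)
  ultimately show ?case by (simp add: harm_Suc distrib_left divide_inverse)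
qed

text \<open>The largest rate that the loads allow is the minimum of capacity \<open>div\<close> load
  over the loaded arcs, so \<open>j\<close> is the load of an arc attaining this minimum.\<close>

lemma candidate_rate:
  assumes "\<And>P. P \<in> set Ps \<Longrightarrow> st_path N P" "Ps \<noteq> []"
    and cap: "\<And>a. a \<in> A \<Longrightarrow> r * load Ps a \<le> net_cap N a"
  obtains a j where "a \<in> A" "1 \<le> j" "j \<le> length Ps" "r \<le> net_cap N a div j"
    "\<And>b. b \<in> A \<Longrightarrow> (net_cap N a div j) * load Ps b \<le> net_cap N b"
proof -
  let ?L = "{a \<in> A. 0 < load Ps a}"
  let ?q = "\<lambda>a. net_cap N a div load Ps a"
  obtain P where P: "P \<in> set Ps" using assms(2) last_in_set by blast
  \<comment> \<open>As \<open>s \<noteq> t\<close>, a path has an arc, so the minimum is over a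
    nonempty set.\<close>
  then have "set P \<subseteq> ?L" "P \<noteq> []"
    using assms(1)[OF P] load_pos_iff s_neq_t by (fastforce simp: st_path_def)+
  then have "?L \<noteq> {}" by (metis set_empty subset_empty)
  moreover have "finite ?L" using finite_A by simp
  ultimately obtain a where "is_arg_min ?q (\<lambda>a. a \<in> ?L) a"
    using ex_is_arg_min_if_finite by blast
  then have a: "a \<in> ?L" "\<And>b. b \<in> ?L \<Longrightarrow> ?q a \<le> ?q b"
    by (auto simp: is_arg_min_linorder)
  show thesis
  proof
    show "a \<in> A" "1 \<le> load Ps a" using a by auto
    show "load Ps a \<le> length Ps" by (rule load_le_length)
    show "r \<le> ?q a" using a(1) cap[of a] by (auto simp: less_eq_div_iff_mult_less_eq)
    show "?q a * load Ps b \<le> net_cap N b" if "b \<in> A" for b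
    proof (cases "0 < load Ps b")
      case True
      then have "?q a * load Ps b \<le> ?q b * load Ps b" using a(2)[of b] that by simp
      also have "\<dots> \<le> net_cap N b" by simp
      finally show ?thesis .
    qed simp
  qed
qed

text \<open>The number of units of rate \<open>r\<close> that fit on an arc. At most
  \<open>p\<close> paths are ever packed, so the bound \<open>p\<close> excludes none of them. For
  \<open>r = 0\<close> the quotient is 0 and no path fits.\<close>

definition rate_caps :: "nat \<Rightarrow> nat \<Rightarrow> 'v \<times> 'v \<Rightarrow> nat" where
  "rate_caps p r a = min (net_cap N a div r) p"

lemma path_flow_list:
  assumes "\<forall>f\<in>set fs. is_path_flow N f"
  shows "\<exists>qs :: (('v \<times> 'v) list \<times> nat) list. length qs = length fs \<and>
    (\<forall>q\<in>set qs. st_path N (fst q)) \<and>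
    (\<forall>a\<in>A. (\<Sum>f\<leftarrow>fs. f a) = int (\<Sum>q\<leftarrow>qs. snd q * of_bool (a \<in> set (fst q))))"
  using assms
proof (induction fs)
  case Nil
  show ?case by (rule exI[of _ "[]"]) simp
next
  case (Cons f fs)
  then obtain qs :: "(('v \<times> 'v) list \<times> nat) list" where qs: "length qs = length fs"
    "\<forall>q\<in>set qs. st_path N (fst q)"
    "\<forall>a\<in>A. (\<Sum>f\<leftarrow>fs. f a) = int (\<Sum>q\<leftarrow>qs. snd q * of_bool (a \<in> set (fst q)))"
    by auto
  obtain P r where P: "st_path N P" "\<forall>a\<in>A. f a = (if a \<in> set P then r else 0)"
    and flow: "is_flow N f"
    using Cons.prems by (auto simp: is_path_flow_def st_path_iff)
  \<comment> \<open>Flows are nonnegative on arcs, so \<open>nat\<close> does not change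
    \<open>r\<close> on the arcs of \<open>P\<close>.\<close>
  have "f a = int (nat r * of_bool (a \<in> set P))" if "a \<in> A" for a
    using P(2) flow that by (auto simp: is_flow_def)
  then show ?case
    using qs P(1) by (intro exI[of _ "(P, nat r) # qs"]) simp
qed

text \<open>\<open>B\<close> bounds just the candidates that the program tries. In an optimal
  decomposition sorted by ascending rate, all paths from position \<open>k\<close> on can carry the
  rate at \<open>k\<close>; raising it to a candidate rate makes the hypothesis applicable and gives
  the premise of \<open>sorted_sum_le_harm\<close>.\<close>

lemma max_le_harm:
  assumes B: "\<And>i j a. i \<in> {1..p} \<Longrightarrow> j \<in> {1..p} \<Longrightarrow> a \<in> A \<Longrightarrow>
      packs N i (rate_caps p (net_cap N a div j)) \<Longrightarrow> i * (net_cap N a div j) \<le> B"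
  shows "real_of_int (max_decomposable_value p N) \<le> real B * harm p"
proof -
  have "max_decomposable_value p N \<in> decomposable_values p N"
    unfolding max_decomposable_value_def
    using finite_decomposable_values[OF network] decomposable_values_nonempty by (rule Max_in)
  then obtain x where x: "max_decomposable_value p N = flow_value N x" "is_flow N x" "decomposable p N x"
    by (auto simp: decomposable_values_def)
  then obtain fs where fs: "length fs \<le> p" "\<forall>f\<in>set fs. is_path_flow N f"
    "\<And>a. a \<in> A \<Longrightarrow> x a = (\<Sum>f\<leftarrow>fs. f a)"
    by (auto simp: decomposable_def)
  obtain qs0 :: "(('v \<times> 'v) list \<times> nat) list" where qs0: "length qs0 = length fs"
    "\<forall>q\<in>set qs0. st_path N (fst q)"
    "\<forall>a\<in>A. (\<Sum>f\<leftarrow>fs. f a) = int (\<Sum>q\<leftarrow>qs0. snd q * of_bool (a \<in> set (fst q)))"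
    using path_flow_list[OF fs(2)] by blast
  define qs where "qs = sort_key snd qs0"
  have "(\<Sum>q\<leftarrow>qs. g q) = (\<Sum>q\<leftarrow>qs0. g q)" for g :: "_ \<Rightarrow> nat"
    unfolding qs_def by (metis mset_map mset_sort sum_mset_sum_list)
  with qs0 have qs: "length qs = length fs" "\<And>q. q \<in> set qs \<Longrightarrow> st_path N (fst q)"
    and x_qs: "\<And>a. a \<in> A \<Longrightarrow> x a = int (\<Sum>q\<leftarrow>qs. snd q * of_bool (a \<in> set (fst q)))"
    using fs(3) by (simp_all add: qs_def)
  have sorted: "sorted (map snd qs)" by (simp add: qs_def)
  have val: "flow_value N x = (\<Sum>q\<leftarrow>qs. int (snd q))"
  proof -
    have "flow_value N x = net_out N (\<lambda>a. \<Sum>q\<leftarrow>qs. int (snd q) * of_bool (a \<in> set (fst q))) s"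
      unfolding flow_value_def
      by (rule net_out_cong) (simp add: x_qs o_def flip: sum_list_of_nat)
    also have "\<dots> = (\<Sum>q\<leftarrow>qs. int (snd q))"
      unfolding net_out_sum_list
      using qs(2) s_neq_t by (intro arg_cong[of _ _ sum_list] map_cong) (auto simp: net_out_scale net_out_st_path)
    finally show ?thesis .
  qed
  have bound: "(length qs - k) * snd (qs ! k) \<le> B" if k: "k < length qs" for k
  proof -
    define r where "r = snd (qs ! k)"
    define Ps where "Ps = map fst (drop k qs)"
    have len: "length Ps = length qs - k" "Ps \<noteq> []" "length Ps \<le> p"
      using k qs(1) fs(1) by (auto simp: Ps_def)
    have Ps: "st_path N P" if "P \<in> set Ps" for P
      using that qs(2) by (auto simp: Ps_def dest: in_set_dropD)
    have ge: "r \<le> snd q" if q: "q \<in> set (drop k qs)" for q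
    proof -
      obtain i where "i < length qs - k" "q = qs ! (k + i)"
        using q by (auto simp: in_set_conv_nth)
      then show ?thesis using sorted_nth_mono[OF sorted, of k "k + i"] by (simp add: r_def)
    qed
    have load_le: "r * load (map fst gs) a \<le> (\<Sum>q\<leftarrow>gs. snd q * of_bool (a \<in> set (fst q)))"
      if "\<And>q. q \<in> set gs \<Longrightarrow> r \<le> snd q" for gs :: "(('v \<times> 'v) list \<times> nat) list" and a
      using that by (induction gs) (auto simp: of_bool_def add_mult_distrib2 intro: add_le_mono)
    have "r * load Ps a \<le> net_cap N a" if a: "a \<in> A" for a
    proof -
      have "r * load Ps a \<le> (\<Sum>q\<leftarrow>drop k qs. snd q * of_bool (a \<in> set (fst q)))"
        unfolding Ps_def using ge by (rule load_le)
      also have "\<dots> \<le> (\<Sum>q\<leftarrow>take k qs @ drop k qs. snd q * of_bool (a \<in> set (fst q)))"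
        by (simp only: map_append sum_list_append le_add2)
      finally have "int (r * load Ps a) \<le> x a"
        by (simp only: x_qs[OF a] of_nat_le_iff append_take_drop_id)
      also have "\<dots> \<le> int (net_cap N a)" using x(2) a by (simp add: is_flow_def)
      finally show ?thesis by (simp only: of_nat_le_iff)
    qed
    then obtain a j where aj: "a \<in> A" "1 \<le> j" "j \<le> length Ps" "r \<le> net_cap N a div j"
      "\<And>b. b \<in> A \<Longrightarrow> (net_cap N a div j) * load Ps b \<le> net_cap N b"
      using candidate_rate[OF Ps len(2)] by blast
    let ?r = "net_cap N a div j"
    show ?thesis
    \<comment> \<open>Only a positive rate can be used to scale the capacities; for rate 0 the bound
      is trivial.\<close>
    proof (cases "r = 0")
      case True
      then show ?thesis by (simp add: r_def)
    next
      case False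
      then have "0 < ?r" using aj(4) by linarith
      then have "load Ps b \<le> rate_caps p ?r b" if "b \<in> A" for b
        using aj(5)[OF that] load_le_length[of Ps b] len(3)
        by (simp add: rate_caps_def less_eq_div_iff_mult_less_eq mult.commute)
      then have "packs N (length Ps) (rate_caps p ?r)" using Ps by (auto simp: packs_def)
      then have "length Ps * ?r \<le> B" using aj len k by (intro B) auto
      moreover have "length Ps * r \<le> length Ps * ?r" using aj(4) by (rule mult_le_mono2)
      ultimately show ?thesis unfolding r_def len(1) by linarith
    qed
  qed
  define vals where "vals = map real (map snd qs)"
  have len_vals: "length vals = length qs" by (simp add: vals_def)
  have "sum_list vals \<le> real B * harm (length vals)"
  proof (rule sorted_sum_le_harm)
    show "sorted vals"
      using sorted by (auto simp: vals_def sorted_iff_nth_mono)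
    fix k assume "k < length vals"
    then have k: "k < length qs" by (simp only: len_vals)
    then have "real ((length qs - k) * snd (qs ! k)) \<le> real B"
      using bound[OF k] by (simp only: of_nat_le_iff)
    moreover have "vals ! k = real (snd (qs ! k))" using k by (simp add: vals_def)
    ultimately show "real (length vals - k) * vals ! k \<le> real B"
      by (simp only: len_vals of_nat_mult)
  qed
  moreover have "real B * harm (length vals) \<le> real B * harm p"
    using qs(1) fs(1) by (intro mult_left_mono harm_mono) (simp_all only: len_vals of_nat_0_le_iff)
  moreover have "real_of_int (max_decomposable_value p N) = sum_list vals"
    unfolding x(1) val vals_def by (simp add: o_def flip: sum_list_of_int)
  ultimately show ?thesis by linarith
qed

end

section \<open>Programs with loops over the arcs\<close>

text \<open>Every loop runs over the arc indices and, by \<open>wf_prog\<close> below, every stored value is bounded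
  by values already in memory or by constants. Hence all numbers keep the bit length of the input,
  and a polynomial running time can be read off the syntax.\<close>

datatype loop_prog =
    LSkip
  | LAssign nat expr expr
  | LSeq loop_prog loop_prog (infixr ";;" 60)
  | LCond expr loop_prog loop_prog
  | LFor nat loop_prog

text \<open>In the encoding, the number of arcs follows the source, the sink, the number of vertices
  and the vertices themselves.\<close>

definition arc_count :: expr where
  "arc_count = Cell 0 (Plus (Const 3) (Cell 0 (Const 2)))"

primrec compile :: "loop_prog \<Rightarrow> program" where
  "compile LSkip = Skip"
| "compile (LAssign a e f) = Assign a e f"
| "compile (LSeq P Q) = Seq (compile P) (compile Q)"
| "compile (LCond e P Q) = Cond e (compile P) (compile Q)"
| "compile (LFor v P) = Seq (Assign v (Const 0) (Const 0))
     (While (Monus arc_count (Cell v (Const 0)))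
       (Seq (compile P) (Assign v (Const 0) (Plus (Cell v (Const 0)) (Const 1)))))"

definition store :: "nat \<Rightarrow> nat \<Rightarrow> nat \<Rightarrow> memory \<Rightarrow> memory" where
  "store a i x m = m(a := (m a)(i := x))"

definition next_index :: "nat \<Rightarrow> memory \<Rightarrow> memory" where
  "next_index v m = store v 0 (Suc (m v 0)) m"

text \<open>\<open>n\<close> stands for the number of arcs. It stays equal to the value of
  \<open>arc_count\<close> because \<open>wf_prog\<close> forbids writing to array 0.\<close>

primrec sem :: "loop_prog \<Rightarrow> nat \<Rightarrow> memory \<Rightarrow> memory" where
  "sem LSkip n m = m"
| "sem (LAssign a e f) n m = store a (eval_expr e m) (eval_expr f m) m"
| "sem (LSeq P Q) n m = sem Q n (sem P n m)"
| "sem (LCond e P Q) n m = (if eval_expr e m \<noteq> 0 then sem P n m else sem Q n m)"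
| "sem (LFor v P) n m = ((\<lambda>m. next_index v (sem P n m)) ^^ n) (store v 0 0 m)"

primrec writes :: "loop_prog \<Rightarrow> nat set" where
  "writes LSkip = {}"
| "writes (LAssign a e f) = {a}"
| "writes (LSeq P Q) = writes P \<union> writes Q"
| "writes (LCond e P Q) = writes P \<union> writes Q"
| "writes (LFor v P) = insert v (writes P)"

text \<open>\<open>Monus\<close> and \<open>Div\<close> do not exceed their left operand, and a
  \<open>Cell\<close> yields a stored number whatever its address. \<open>Plus\<close> and
  \<open>Times\<close> remain available in addresses, conditions and right operands, from where they
  cannot make stored numbers grow.\<close>

primrec nongrowing :: "nat \<Rightarrow> expr \<Rightarrow> bool" where
  "nongrowing K (Const c) \<longleftrightarrow> c \<le> K"
| "nongrowing K (Cell a e) \<longleftrightarrow> True"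
| "nongrowing K (Plus e f) \<longleftrightarrow> False"
| "nongrowing K (Monus e f) \<longleftrightarrow> nongrowing K e"
| "nongrowing K (Times e f) \<longleftrightarrow> False"
| "nongrowing K (Div e f) \<longleftrightarrow> nongrowing K e"

primrec wf_prog :: "nat \<Rightarrow> loop_prog \<Rightarrow> bool" where
  "wf_prog K LSkip \<longleftrightarrow> True"
| "wf_prog K (LAssign a e f) \<longleftrightarrow> a \<noteq> 0 \<and> nongrowing K f"
| "wf_prog K (LSeq P Q) \<longleftrightarrow> wf_prog K P \<and> wf_prog K Q"
| "wf_prog K (LCond e P Q) \<longleftrightarrow> wf_prog K P \<and> wf_prog K Q"
| "wf_prog K (LFor v P) \<longleftrightarrow> v \<noteq> 0 \<and> v \<notin> writes P \<and> wf_prog K P"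

declare sem.simps(5) [simp del]

lemma store_apply [simp]:
  "store a i x m a = (m a)(i := x)"
  "b \<noteq> a \<Longrightarrow> store a i x m b = m b"
  by (simp_all add: store_def)

lemma next_index_apply [simp]:
  "next_index v m v 0 = Suc (m v 0)"
  "b \<noteq> v \<Longrightarrow> next_index v m b = m b"
  by (simp_all add: next_index_def)

lemma sem_frame: "a \<notin> writes P \<Longrightarrow> sem P n m a = m a"
proof (induction P arbitrary: m)
  case (LFor v P)
  have "((\<lambda>m. next_index v (sem P n m)) ^^ k) m' a = m' a" for k m'
    using LFor by (induction k) auto
  then show ?case using LFor.prems by (simp add: sem.simps(5))
qed auto

text \<open>The invariant \<open>I\<close> must not mention the loop variable, whose value is supplied separately.\<close>

lemma sem_LFor:
  assumes "v \<notin> writes P" and "I 0 (store v 0 0 m)"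
    and step: "\<And>i m. i < n \<Longrightarrow> I i m \<Longrightarrow> m v 0 = i \<Longrightarrow> I (Suc i) (next_index v (sem P n m))"
  shows "I n (sem (LFor v P) n m)"
proof -
  let ?f = "\<lambda>m. next_index v (sem P n m)"
  have "k \<le> n \<Longrightarrow> I k ((?f ^^ k) (store v 0 0 m)) \<and> (?f ^^ k) (store v 0 0 m) v 0 = k" for k
  proof (induction k)
    case 0
    with assms(2) show ?case by simp
  next
    case (Suc k)
    then show ?case using step sem_frame[OF assms(1)] by simp
  qed
  then show ?thesis by (simp add: sem.simps(5))
qed

section \<open>Bit lengths and running times\<close>

definition bounded_memory :: "nat \<Rightarrow> nat \<Rightarrow> memory \<Rightarrow> bool" where
  "bounded_memory L n m \<longleftrightarrow> (\<forall>a i. m a i < 2 ^ L) \<and> m 0 (3 + m 0 2) = n \<and> n \<le> L"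

lemma bounded_memory_less: "bounded_memory L n m \<Longrightarrow> \<forall>a i. m a i < 2 ^ L"
  by (simp add: bounded_memory_def)

lemma nat_size_le: "x < 2 ^ b \<Longrightarrow> nat_size x \<le> 1 + b"
  by (simp add: nat_size_def floorlog_leI)

lemma less_two_power_nat_size: "x < 2 ^ nat_size x"
proof (cases "x = 0")
  case False
  then have "x < 2 ^ floorlog 2 x" using floorlog_bounds[of x 2] by simp
  then show ?thesis by (simp add: nat_size_def)
qed (simp add: nat_size_def)

text \<open>Exponents add up under \<open>Times\<close> and \<open>Plus\<close>, so bit lengths grow
  by a factor that depends on the syntax only. \<open>0 < s\<close> keeps both powers at least 2,
  where a sum is at most the product.\<close>

lemma eval_expr_less:
  "\<exists>s>0. \<forall>L m. 1 \<le> L \<longrightarrow> (\<forall>a i. m a i < 2 ^ L) \<longrightarrow> eval_expr e m < 2 ^ (s * L)"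
proof (induction e)
  case (Const c)
  have "c < 2 ^ (Suc c * L)" if "1 \<le> L" for L
  proof -
    have "c < 2 ^ Suc c" using less_exp[of "Suc c"] by linarith
    also have "\<dots> \<le> 2 ^ (Suc c * L)"
      using mult_le_mono2[OF that, of "Suc c"] by (intro power_increasing) simp_all
    finally show ?thesis .
  qed
  then show ?case by (intro exI[of _ "Suc c"]) simp
next
  case (Cell a e)
  show ?case by (intro exI[of _ 1]) simp
next
  case (Monus e f)
  then obtain s where "0 < s"
    "\<forall>L m. 1 \<le> L \<longrightarrow> (\<forall>a i. m a i < 2 ^ L) \<longrightarrow> eval_expr e m < 2 ^ (s * L)" by blast
  then show ?case by (intro exI[of _ s]) (auto intro: le_less_trans[OF diff_le_self])
next
  case (Div e f)
  then obtain s where "0 < s"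
    "\<forall>L m. 1 \<le> L \<longrightarrow> (\<forall>a i. m a i < 2 ^ L) \<longrightarrow> eval_expr e m < 2 ^ (s * L)" by blast
  then show ?case by (intro exI[of _ s]) (auto intro: le_less_trans[OF div_le_dividend])
next
  case (Plus e f)
  then obtain s s' where s: "0 < s" "0 < s'"
    "\<forall>L m. 1 \<le> L \<longrightarrow> (\<forall>a i. m a i < 2 ^ L) \<longrightarrow> eval_expr e m < 2 ^ (s * L)"
    "\<forall>L m. 1 \<le> L \<longrightarrow> (\<forall>a i. m a i < 2 ^ L) \<longrightarrow> eval_expr f m < 2 ^ (s' * L)" by blast
  have "x + y < 2 ^ ((s + s') * L)" if "1 \<le> L" "x < 2 ^ (s * L)" "y < 2 ^ (s' * L)" for x y L :: nat
  proof -
    have "1 \<le> s * L" "1 \<le> s' * L" using s that by (simp_all add: Suc_le_eq)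
    then have "(2::nat) ^ 1 \<le> 2 ^ (s * L)" "(2::nat) ^ 1 \<le> 2 ^ (s' * L)"
      by (intro power_increasing; simp)+
    moreover have "a + b \<le> a * b" if "2 \<le> a" "2 \<le> b" for a b :: nat
      using mult_le_mono[OF that(1) le_refl[of b]] mult_le_mono[OF le_refl[of a] that(2)] by linarith
    ultimately have "2 ^ (s * L) + 2 ^ (s' * L) \<le> (2::nat) ^ (s * L) * 2 ^ (s' * L)"
      by (metis power_one_right)
    then show ?thesis using that by (simp add: power_add add_mult_distrib)
  qed
  with s show ?case by (intro exI[of _ "s + s'"]) simp
next
  case (Times e f)
  then obtain s s' where s: "0 < s" "0 < s'"
    "\<forall>L m. 1 \<le> L \<longrightarrow> (\<forall>a i. m a i < 2 ^ L) \<longrightarrow> eval_expr e m < 2 ^ (s * L)"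
    "\<forall>L m. 1 \<le> L \<longrightarrow> (\<forall>a i. m a i < 2 ^ L) \<longrightarrow> eval_expr f m < 2 ^ (s' * L)" by blast
  have "x * y < 2 ^ ((s + s') * L)" if "x < 2 ^ (s * L)" "y < 2 ^ (s' * L)" for x y L :: nat
    using mult_strict_mono'[OF that] by (simp add: power_add add_mult_distrib)
  with s show ?case by (intro exI[of _ "s + s'"]) simp
qed

lemma nat_size_eval_expr_le:
  "\<exists>c. \<forall>L m. 1 \<le> L \<longrightarrow> (\<forall>a i. m a i < 2 ^ L) \<longrightarrow> nat_size (eval_expr e m) \<le> c * L"
proof -
  obtain s where s: "\<forall>L m. 1 \<le> L \<longrightarrow> (\<forall>a i. m a i < 2 ^ L) \<longrightarrow> eval_expr e m < 2 ^ (s * L)"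
    using eval_expr_less by blast
  have "nat_size (eval_expr e m) \<le> Suc s * L" if "1 \<le> L" "\<forall>a i. m a i < 2 ^ L" for L m
    using nat_size_le[of "eval_expr e m" "s * L"] s that by fastforce
  then show ?thesis by blast
qed

lemma expr_cost_le:
  "\<exists>c. \<forall>L m. 1 \<le> L \<longrightarrow> (\<forall>a i. m a i < 2 ^ L) \<longrightarrow> expr_cost e m \<le> c * L"
proof (induction e)
  case (Const c)
  show ?case using nat_size_eval_expr_le[of "Const c"] by simp
next
  case (Cell a e)
  then obtain c where c: "\<forall>L m. 1 \<le> L \<longrightarrow> (\<forall>a i. m a i < 2 ^ L) \<longrightarrow> expr_cost e m \<le> c * L" by blast
  obtain d where d: "\<forall>L m. 1 \<le> L \<longrightarrow> (\<forall>a i. m a i < 2 ^ L) \<longrightarrow> nat_size (eval_expr (Cell a e) m) \<le> d * L"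
    using nat_size_eval_expr_le by blast
  show ?case using c d
    by (intro exI[of _ "d + c"]) (auto simp: add_mult_distrib intro!: add_le_mono simp del: eval_expr.simps)
next
  case (Plus e f)
  then obtain c c' where c: "\<forall>L m. 1 \<le> L \<longrightarrow> (\<forall>a i. m a i < 2 ^ L) \<longrightarrow> expr_cost e m \<le> c * L"
    "\<forall>L m. 1 \<le> L \<longrightarrow> (\<forall>a i. m a i < 2 ^ L) \<longrightarrow> expr_cost f m \<le> c' * L" by blast
  obtain d where d: "\<forall>L m. 1 \<le> L \<longrightarrow> (\<forall>a i. m a i < 2 ^ L) \<longrightarrow> nat_size (eval_expr (Plus e f) m) \<le> d * L"
    using nat_size_eval_expr_le by blast
  show ?case using c d
    by (intro exI[of _ "d + c + c'"]) (auto simp: add_mult_distrib intro!: add_le_mono simp del: eval_expr.simps)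
next
  case (Monus e f)
  then obtain c c' where c: "\<forall>L m. 1 \<le> L \<longrightarrow> (\<forall>a i. m a i < 2 ^ L) \<longrightarrow> expr_cost e m \<le> c * L"
    "\<forall>L m. 1 \<le> L \<longrightarrow> (\<forall>a i. m a i < 2 ^ L) \<longrightarrow> expr_cost f m \<le> c' * L" by blast
  obtain d where d: "\<forall>L m. 1 \<le> L \<longrightarrow> (\<forall>a i. m a i < 2 ^ L) \<longrightarrow> nat_size (eval_expr (Monus e f) m) \<le> d * L"
    using nat_size_eval_expr_le by blast
  show ?case using c d
    by (intro exI[of _ "d + c + c'"]) (auto simp: add_mult_distrib intro!: add_le_mono simp del: eval_expr.simps)
next
  case (Times e f)
  then obtain c c' where c: "\<forall>L m. 1 \<le> L \<longrightarrow> (\<forall>a i. m a i < 2 ^ L) \<longrightarrow> expr_cost e m \<le> c * L"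
    "\<forall>L m. 1 \<le> L \<longrightarrow> (\<forall>a i. m a i < 2 ^ L) \<longrightarrow> expr_cost f m \<le> c' * L" by blast
  obtain d where d: "\<forall>L m. 1 \<le> L \<longrightarrow> (\<forall>a i. m a i < 2 ^ L) \<longrightarrow> nat_size (eval_expr (Times e f) m) \<le> d * L"
    using nat_size_eval_expr_le by blast
  show ?case using c d
    by (intro exI[of _ "d + c + c'"]) (auto simp: add_mult_distrib intro!: add_le_mono simp del: eval_expr.simps)
next
  case (Div e f)
  then obtain c c' where c: "\<forall>L m. 1 \<le> L \<longrightarrow> (\<forall>a i. m a i < 2 ^ L) \<longrightarrow> expr_cost e m \<le> c * L"
    "\<forall>L m. 1 \<le> L \<longrightarrow> (\<forall>a i. m a i < 2 ^ L) \<longrightarrow> expr_cost f m \<le> c' * L" by blast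
  obtain d where d: "\<forall>L m. 1 \<le> L \<longrightarrow> (\<forall>a i. m a i < 2 ^ L) \<longrightarrow> nat_size (eval_expr (Div e f) m) \<le> d * L"
    using nat_size_eval_expr_le by blast
  show ?case using c d
    by (intro exI[of _ "d + c + c'"]) (auto simp: add_mult_distrib intro!: add_le_mono simp del: eval_expr.simps)
qed

lemma nongrowing_eval_less:
  assumes "nongrowing K e" "K \<le> L" "\<forall>a i. m a i < 2 ^ L"
  shows "eval_expr e m < 2 ^ L"
  using assms(1)
proof (induction e)
  case (Const c)
  then show ?case using assms(2) by (auto intro!: le_less_trans[OF _ less_exp])
qed (use assms(3) in \<open>auto intro: le_less_trans[OF diff_le_self] le_less_trans[OF div_le_dividend]\<close>)

lemma bounded_memory_store:
  assumes "bounded_memory L n m" "a \<noteq> 0" "x < 2 ^ L"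
  shows "bounded_memory L n (store a i x m)"
  using assms by (auto simp: bounded_memory_def store_def)

text \<open>One number \<open>L\<close> bounds the bit lengths, the constants and the number of
  iterations. Since the same \<open>L\<close> is still valid afterwards, costs add up in sequences
  and are multiplied by at most \<open>L\<close> in loops.\<close>

definition poly_time :: "nat \<Rightarrow> loop_prog \<Rightarrow> nat poly \<Rightarrow> bool" where
  "poly_time K P q \<longleftrightarrow> (\<forall>L n m. 1 \<le> L \<longrightarrow> K \<le> L \<longrightarrow> bounded_memory L n m \<longrightarrow>
     bounded_memory L n (sem P n m) \<and>
     (\<exists>T\<le>poly q L. exec (compile P) m T (sem P n m)))"

lemma poly_timeE:
  assumes "poly_time K P q" "1 \<le> L" "K \<le> L" "bounded_memory L n m"
  obtains T where "bounded_memory L n (sem P n m)" "T \<le> poly q L" "exec (compile P) m T (sem P n m)"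
  using assms unfolding poly_time_def by blast

lemma poly_time_LAssign:
  assumes "wf_prog K (LAssign a e f)"
  shows "\<exists>q. poly_time K (LAssign a e f) q"
proof -
  obtain c where c: "\<forall>L m. 1 \<le> L \<longrightarrow> (\<forall>a i. m a i < 2 ^ L) \<longrightarrow> expr_cost e m \<le> c * L"
    using expr_cost_le by blast
  obtain d where d: "\<forall>L m. 1 \<le> L \<longrightarrow> (\<forall>a i. m a i < 2 ^ L) \<longrightarrow> expr_cost f m \<le> d * L"
    using expr_cost_le by blast
  have "poly_time K (LAssign a e f) [:1, c + d:]"
    unfolding poly_time_def
  proof (intro allI impI conjI)
    fix L n m assume L: "1 \<le> L" "K \<le> L" and m: "bounded_memory L n m"
    note m' = bounded_memory_less[OF m]
    show "bounded_memory L n (sem (LAssign a e f) n m)"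
      using assms m nongrowing_eval_less[OF _ L(2) m', of f] by (auto intro!: bounded_memory_store)
    have "expr_cost e m \<le> c * L" "expr_cost f m \<le> d * L" using c d L m' by blast+
    then have "1 + expr_cost e m + expr_cost f m \<le> poly [:1, c + d:] L"
      by (simp add: algebra_simps)
    then show "\<exists>T\<le>poly [:1, c + d:] L. exec (compile (LAssign a e f)) m T (sem (LAssign a e f) n m)"
      using exec.Assign[of a e f m] by (auto simp: store_def)
  qed
  then show ?thesis ..
qed

lemma poly_time_LFor:
  assumes "wf_prog K (LFor v P)" "poly_time K P q"
  shows "\<exists>q. poly_time K (LFor v P) q"
proof -
  let ?cond = "Monus arc_count (Cell v (Const 0))"
  let ?succ = "Plus (Cell v (Const 0)) (Const 1)"
  let ?inc = "Assign v (Const 0) ?succ"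
  obtain c where c: "\<forall>L m. 1 \<le> L \<longrightarrow> (\<forall>a i. m a i < 2 ^ L) \<longrightarrow> expr_cost ?cond m \<le> c * L"
    using expr_cost_le by blast
  obtain d where d: "\<forall>L m. 1 \<le> L \<longrightarrow> (\<forall>a i. m a i < 2 ^ L) \<longrightarrow>
      expr_cost ?succ m \<le> d * L"
    using expr_cost_le by blast
  obtain z where z: "\<forall>L m. 1 \<le> L \<longrightarrow> (\<forall>a i. m a i < 2 ^ L) \<longrightarrow> expr_cost (Const 0) m \<le> z * L"
    using expr_cost_le by blast
  \<comment> \<open>One iteration: \<open>c\<close> pays for the condition, \<open>z\<close> and
    \<open>d\<close> for the increment, \<open>q\<close> for the body, and 3 for the constructors
    \<open>While\<close>, \<open>Seq\<close> and \<open>Assign\<close>.\<close>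
  let ?r = "[:3, c + z + d:] + q"
  have poly_r: "poly ?r L = 3 + c * L + (z + d) * L + poly q L" for L
    by (simp add: algebra_simps)
  let ?f = "\<lambda>n m. next_index v (sem P n m)"
  have step: "bounded_memory L n (?f n m) \<and> ?f n m v 0 = Suc (m v 0) \<and>
      (\<exists>T\<le>2 + poly q L + (z + d) * L. exec (Seq (compile P) ?inc) m T (?f n m))"
    if L: "1 \<le> L" "K \<le> L" and m: "bounded_memory L n m" "m v 0 < n" for L n m
  proof -
    obtain T where m': "bounded_memory L n (sem P n m)"
      and T: "T \<le> poly q L" "exec (compile P) m T (sem P n m)"
      using poly_timeE[OF assms(2) L m(1)] .
    have v: "sem P n m v = m v" using assms(1) by (intro sem_frame) simp
    \<comment> \<open>The increment is the one assignment that is not \<open>nongrowing\<close>; the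
      counter is bounded by the number of arcs instead.\<close>
    have "Suc (m v 0) \<le> L" using m by (simp add: bounded_memory_def)
    then have "Suc (m v 0) < 2 ^ L" using less_exp[of L] by linarith
    with m' assms(1) v have bounded: "bounded_memory L n (?f n m)"
      unfolding next_index_def by (intro bounded_memory_store) simp_all
    let ?U = "1 + expr_cost (Const 0) (sem P n m) + expr_cost ?succ (sem P n m)"
    have "exec ?inc (sem P n m) ?U (?f n m)"
      using exec.Assign[of v "Const 0" ?succ "sem P n m"] by (simp add: next_index_def store_def)
    note run = exec.Seq[OF T(2) this]
    have "expr_cost (Const 0) (sem P n m) \<le> z * L" "expr_cost ?succ (sem P n m) \<le> d * L"
      using z d L(1) bounded_memory_less[OF m'] by blast+
    then have "1 + T + ?U \<le> 2 + poly q L + (z + d) * L"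
      using T(1) unfolding add_mult_distrib by linarith
    moreover have "?f n m v 0 = Suc (m v 0)" by (simp add: v)
    ultimately show ?thesis using run bounded by blast
  qed
  have loop: "bounded_memory L n ((?f n ^^ k) m) \<and>
      (\<exists>T\<le>1 + c * L + k * poly ?r L. exec (While ?cond (Seq (compile P) ?inc)) m T ((?f n ^^ k) m))"
    if L: "1 \<le> L" "K \<le> L" and "bounded_memory L n m" "m v 0 + k = n" for L n m k
    using that(3,4)
  proof (induction k arbitrary: m)
    case 0
    then have cond: "eval_expr ?cond m = 0" by (simp add: arc_count_def bounded_memory_def)
    have "expr_cost ?cond m \<le> c * L" using c L(1) bounded_memory_less[OF 0(1)] by blast
    then have "1 + expr_cost ?cond m \<le> 1 + c * L + 0 * poly ?r L" by linarith
    moreover have "(?f n ^^ 0) m = m" by simp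
    ultimately show ?case using 0(1) exec.WhileFalse[OF cond] by metis
  next
    case (Suc k)
    then have cond: "eval_expr ?cond m \<noteq> 0" by (simp add: arc_count_def bounded_memory_def)
    have cost: "expr_cost ?cond m \<le> c * L" using c L(1) bounded_memory_less[OF Suc.prems(1)] by blast
    obtain T where T: "bounded_memory L n (?f n m)" "?f n m v 0 = Suc (m v 0)"
      "T \<le> 2 + poly q L + (z + d) * L" "exec (Seq (compile P) ?inc) m T (?f n m)"
      using step[OF L Suc.prems(1)] Suc.prems(2) by auto
    have IH: "bounded_memory L n ((?f n ^^ k) (?f n m))" and
      "\<exists>U\<le>1 + c * L + k * poly ?r L. exec (While ?cond (Seq (compile P) ?inc)) (?f n m) U ((?f n ^^ k) (?f n m))"
      using Suc.IH[OF T(1)] T(2) Suc.prems(2) by auto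
    then obtain U where U: "U \<le> 1 + c * L + k * poly ?r L"
      "exec (While ?cond (Seq (compile P) ?inc)) (?f n m) U ((?f n ^^ k) (?f n m))" by blast
    have "1 + expr_cost ?cond m + T + U \<le> 1 + c * L + Suc k * poly ?r L"
      using cost T(3) U(1) unfolding poly_r mult_Suc by linarith
    moreover have "(?f n ^^ k) (?f n m) = (?f n ^^ Suc k) m" by (simp only: funpow_Suc_right o_apply)
    ultimately show ?case
      using IH exec.WhileTrue[OF cond T(4) U(2)] by metis
  qed
  have poly_total: "poly ([:3, z + z + c:] + [:0, 1:] * ?r) L = 3 + 2 * (z * L) + c * L + L * poly ?r L" for L
    by (simp add: algebra_simps)
  have "poly_time K (LFor v P) ([:3, z + z + c:] + [:0, 1:] * ?r)"
    unfolding poly_time_def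
  proof (intro allI impI)
    fix L n m assume L: "1 \<le> L" "K \<le> L" and m: "bounded_memory L n m"
    let ?m = "store v 0 0 m"
    have m0: "bounded_memory L n ?m" using m assms(1) by (intro bounded_memory_store) auto
    obtain T where T: "bounded_memory L n (sem (LFor v P) n m)" "T \<le> 1 + c * L + n * poly ?r L"
      "exec (While ?cond (Seq (compile P) ?inc)) ?m T (sem (LFor v P) n m)"
      using loop[OF L m0, of n] assms(1) by (auto simp: sem.simps(5))
    have "exec (Assign v (Const 0) (Const 0)) m (1 + expr_cost (Const 0) m + expr_cost (Const 0) m) ?m"
      using exec.Assign[of v "Const 0" "Const 0" m] by (simp add: store_def)
    note run = exec.Seq[OF this T(3)]
    have "expr_cost (Const 0) m \<le> z * L" using z L(1) bounded_memory_less[OF m] by blast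
    moreover have "n * poly ?r L \<le> L * poly ?r L" using m by (intro mult_le_mono1) (simp add: bounded_memory_def)
    ultimately have "1 + (1 + expr_cost (Const 0) m + expr_cost (Const 0) m) + T
        \<le> poly ([:3, z + z + c:] + [:0, 1:] * ?r) L"
      using T(2) unfolding poly_total by linarith
    with run T(1) show "bounded_memory L n (sem (LFor v P) n m) \<and>
       (\<exists>T\<le>poly ([:3, z + z + c:] + [:0, 1:] * ?r) L. exec (compile (LFor v P)) m T (sem (LFor v P) n m))"
      unfolding compile.simps by blast
  qed
  then show ?thesis ..
qed

lemma poly_time_if_wf_prog: "wf_prog K P \<Longrightarrow> \<exists>q. poly_time K P q"
proof (induction P)
  case LSkip
  have "poly_time K LSkip [:1:]"
    unfolding poly_time_def using exec.Skip by auto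
  then show ?case ..
next
  case (LAssign a e f)
  then show ?case by (rule poly_time_LAssign)
next
  case (LSeq P Q)
  then obtain p q where pq: "poly_time K P p" "poly_time K Q q" by auto
  have "poly_time K (LSeq P Q) ([:1:] + p + q)"
    unfolding poly_time_def
  proof (intro allI impI)
    fix L n m assume L: "1 \<le> L" "K \<le> L" and m: "bounded_memory L n m"
    obtain T where T: "bounded_memory L n (sem P n m)" "T \<le> poly p L" "exec (compile P) m T (sem P n m)"
      using poly_timeE[OF pq(1) L m] .
    obtain U where U: "bounded_memory L n (sem Q n (sem P n m))" "U \<le> poly q L"
      "exec (compile Q) (sem P n m) U (sem Q n (sem P n m))"
      using poly_timeE[OF pq(2) L T(1)] .
    show "bounded_memory L n (sem (LSeq P Q) n m) \<and>
        (\<exists>T\<le>poly ([:1:] + p + q) L. exec (compile (LSeq P Q)) m T (sem (LSeq P Q) n m))"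
      using T(2) U exec.Seq[OF T(3) U(3)] by (intro conjI exI[of _ "1 + T + U"]) simp_all
  qed
  then show ?case ..
next
  case (LCond e P Q)
  then obtain p q where pq: "poly_time K P p" "poly_time K Q q" by auto
  obtain c where c: "\<forall>L m. 1 \<le> L \<longrightarrow> (\<forall>a i. m a i < 2 ^ L) \<longrightarrow> expr_cost e m \<le> c * L"
    using expr_cost_le by blast
  have "poly_time K (LCond e P Q) ([:1, c:] + p + q)"
    unfolding poly_time_def
  proof (intro allI impI)
    fix L n m assume L: "1 \<le> L" "K \<le> L" and m: "bounded_memory L n m"
    have cost: "expr_cost e m \<le> c * L" using c L(1) bounded_memory_less[OF m] by blast
    show "bounded_memory L n (sem (LCond e P Q) n m) \<and>
        (\<exists>T\<le>poly ([:1, c:] + p + q) L. exec (compile (LCond e P Q)) m T (sem (LCond e P Q) n m))"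
    proof (cases "eval_expr e m = 0")
      case True
      obtain T where "bounded_memory L n (sem Q n m)" "T \<le> poly q L" "exec (compile Q) m T (sem Q n m)"
        using poly_timeE[OF pq(2) L m] .
      with True cost exec.CondFalse[OF True this(3)] show ?thesis
        by (intro conjI exI[of _ "1 + expr_cost e m + T"]) (simp_all add: algebra_simps)
    next
      case False
      obtain T where "bounded_memory L n (sem P n m)" "T \<le> poly p L" "exec (compile P) m T (sem P n m)"
        using poly_timeE[OF pq(1) L m] .
      with False cost exec.CondTrue[OF False this(3)] show ?thesis
        by (intro conjI exI[of _ "1 + expr_cost e m + T"]) (simp_all add: algebra_simps)
    qed
  qed
  then show ?case ..
next
  case (LFor v P)
  then obtain q where "poly_time K P q" by auto
  with LFor.prems show ?case by (rule poly_time_LFor)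
qed

lemma exec_compile_poly:
  assumes "wf_prog K P"
  shows "\<exists>q. \<forall>xs n. 2 < length xs \<longrightarrow> 3 + xs ! 2 < length xs \<longrightarrow> n = xs ! (3 + xs ! 2) \<longrightarrow> n \<le> length xs \<longrightarrow>
    (\<exists>T\<le>poly q (input_size xs). exec (compile P) (input_memory xs) T (sem P n (input_memory xs)))"
proof -
  obtain q where q: "poly_time K P q" using poly_time_if_wf_prog[OF assms] by blast
  \<comment> \<open>The composition substitutes \<open>Suc K + input_size xs\<close> for
    \<open>L\<close>, where \<open>Suc K\<close> ensures \<open>1 \<le> L\<close> and
    \<open>K \<le> L\<close>.\<close>
  have "\<exists>T\<le>poly (pcompose q [:Suc K, 1:]) (input_size xs).
      exec (compile P) (input_memory xs) T (sem P n (input_memory xs))"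
    if xs: "2 < length xs" "3 + xs ! 2 < length xs" "n = xs ! (3 + xs ! 2)" "n \<le> length xs" for xs n
  proof -
    let ?L = "Suc K + input_size xs"
    have "length xs = (\<Sum>x\<leftarrow>xs. 1)" by (simp add: sum_list_triv)
    also have "\<dots> \<le> input_size xs"
      unfolding input_size_def by (rule sum_list_mono) (simp add: nat_size_def)
    finally have "n \<le> ?L" using xs(4) by simp
    moreover have "input_memory xs a i < 2 ^ ?L" for a i
    proof (cases "a = 0 \<and> i < length xs")
      case True
      then have "nat_size (xs ! i) \<le> input_size xs"
        unfolding input_size_def by (intro member_le_sum_list) auto
      then have "(2::nat) ^ nat_size (xs ! i) \<le> 2 ^ ?L" by (intro power_increasing) auto
      with True show ?thesis using less_two_power_nat_size[of "xs ! i"]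
        by (simp add: input_memory_def)
    qed (auto simp: input_memory_def)
    ultimately have "bounded_memory ?L n (input_memory xs)"
      using xs by (simp add: bounded_memory_def input_memory_def)
    with q have "\<exists>T\<le>poly q ?L. exec (compile P) (input_memory xs) T (sem P n (input_memory xs))"
      unfolding poly_time_def by simp
    then show ?thesis by (simp add: poly_pcompose add.commute)
  qed
  then show ?thesis by blast
qed

section \<open>The algorithm\<close>

text \<open>Array 1 holds the output, 2 the arc capacities of the current instance, 3 the vertex marks of
  the search, and cell 0 of array 4 the answer of the packing test. Cell 0 of arrays 5, 6 and 7
  holds the number of paths and the rate of the best solution and the current rate; the
  remaining arrays are used for saved values and loop variables.\<close>

abbreviation var :: "nat \<Rightarrow> expr" where
  "var v \<equiv> Cell v (Const 0)"

text \<open>Four numbers and the vertices precede the arcs, each of which takes three cells: tail,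
  head and capacity.\<close>

definition arc_field :: "nat \<Rightarrow> expr \<Rightarrow> expr" where
  "arc_field k e = Cell 0 (Plus (Plus (Const (4 + k)) (Cell 0 (Const 2))) (Times (Const 3) e))"

abbreviation "arc_tail \<equiv> arc_field 0"
abbreviation "arc_head \<equiv> arc_field (Suc 0)"
abbreviation "arc_cap \<equiv> arc_field 2"

text \<open>Vertices are arbitrary numbers used directly as addresses, so marks are cleared through
  the ends of the arcs. The source is marked last, as clearing could erase its mark.\<close>

definition reset_prog :: loop_prog where
  "reset_prog =
     LFor 9 (LAssign 3 (arc_tail (var 9)) (Const 0) ;; LAssign 3 (arc_head (var 9)) (Const 0)) ;;
     LAssign 3 (Cell 0 (Const 1)) (Const 0) ;;
     LAssign 3 (Cell 0 (Const 0)) (Const 1)"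

text \<open>The product serves as a conjunction. Marks are updated in place, so one round can
  advance along several arcs.\<close>

definition round_prog :: loop_prog where
  "round_prog = LFor 9
     (LCond (Times (Cell 3 (arc_tail (var 9))) (Cell 2 (var 9)))
       (LAssign 3 (arc_head (var 9)) (Const 1)) LSkip)"

text \<open>As many rounds as there are arcs suffice, since a shortest path repeats no arc. The
  answer is only ever cleared here, so it accumulates the conjunction of all searches since it was
  set to 1.\<close>

definition reach_prog :: loop_prog where
  "reach_prog = reset_prog ;; LFor 10 round_prog ;;
     LCond (Cell 3 (Cell 0 (Const 1))) LSkip (LAssign 4 (Const 0) (Const 0))"

text \<open>Nested levels need separate arrays, two per level: for the loop variable and for the
  saved capacity. The latter is saved because \<open>Monus\<close> at 0 cannot be undone by adding
  1.\<close>

primrec test_prog :: "nat \<Rightarrow> loop_prog" where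
  "test_prog 0 = reach_prog"
| "test_prog (Suc k) = LFor (20 + 2 * k)
     (LAssign (21 + 2 * k) (Const 0) (Cell 2 (var (20 + 2 * k))) ;;
      LAssign 2 (var (20 + 2 * k)) (Monus (Cell 2 (var (20 + 2 * k))) (Const 1)) ;;
      test_prog k ;;
      LAssign 2 (var (20 + 2 * k)) (var (21 + 2 * k)))"

text \<open>\<open>Monus a (Monus a b)\<close> is \<open>min a b\<close>, in a form accepted by \<open>nongrowing\<close>.\<close>

definition setup_prog :: "nat \<Rightarrow> loop_prog" where
  "setup_prog p = LFor 9 (LAssign 2 (var 9)
     (Monus (Div (arc_cap (var 9)) (var 7)) (Monus (Div (arc_cap (var 9)) (var 7)) (Const p))))"

definition lower_prog :: "nat \<Rightarrow> loop_prog" where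
  "lower_prog k =
     LAssign 8 (Const 0) (Cell 2 (var 11)) ;;
     LAssign 2 (var 11) (Monus (Cell 2 (var 11)) (Const 1)) ;;
     LAssign 4 (Const 0) (Const 1) ;;
     test_prog k ;;
     LCond (var 4) LSkip (LAssign 2 (var 11) (var 8))"

primrec repeat_prog :: "nat \<Rightarrow> loop_prog \<Rightarrow> loop_prog" where
  "repeat_prog 0 P = LSkip"
| "repeat_prog (Suc q) P = P ;; repeat_prog q P"

text \<open>Capacities are at most \<open>p\<close>, so \<open>p\<close> attempts settle an arc. A
  single pass over the arcs is enough because lowering further arcs only makes packing
  harder.\<close>

definition minimize_prog :: "nat \<Rightarrow> nat \<Rightarrow> loop_prog" where
  "minimize_prog p k = LFor 11 (repeat_prog p (lower_prog k))"

text \<open>The product of rate and units alone is not \<open>nongrowing\<close>. The minimum with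
  the capacity is, and it changes nothing as the packed paths respect the capacities.\<close>

definition output_prog :: loop_prog where
  "output_prog = LFor 9 (LAssign 1 (var 9)
     (Monus (arc_cap (var 9)) (Monus (arc_cap (var 9)) (Times (var 7) (Cell 2 (var 9))))))"

text \<open>The output is overwritten only if the packing exists and beats the best value so far.
  That value is kept as two factors since a stored product would not be
  \<open>nongrowing\<close>.\<close>

definition candidate_prog :: "nat \<Rightarrow> nat \<Rightarrow> nat \<Rightarrow> loop_prog" where
  "candidate_prog p i j =
     LAssign 7 (Const 0) (Div (arc_cap (var 12)) (Const j)) ;;
     setup_prog p ;;
     LAssign 4 (Const 0) (Const 1) ;;
     test_prog (i - 1) ;;
     LCond (Times (var 4) (Monus (Times (Const i) (var 7)) (Times (var 5) (var 6))))
       (LAssign 5 (Const 0) (Const i) ;;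
        LAssign 6 (Const 0) (var 7) ;;
        minimize_prog p (i - 1) ;;
        output_prog)
       LSkip"

text \<open>As \<open>p\<close> is fixed, the pairs \<open>(i, j)\<close> are unrolled in the
  program; only the arc that determines the rate is found by a loop.\<close>

definition main_prog :: "nat \<Rightarrow> loop_prog" where
  "main_prog p = foldr (\<lambda>(i, j) P. LFor 12 (candidate_prog p i j) ;; P)
     (List.product [1..<Suc p] [1..<Suc p]) LSkip"

section \<open>Well-formedness of the programs\<close>

lemma nongrowing_arc_field [simp]: "nongrowing K (arc_field k e)"
  by (simp add: arc_field_def)

lemma writes_reach_prog [simp]: "writes reach_prog = {3, 4, 9, 10}"
  by (auto simp: reach_prog_def reset_prog_def round_prog_def)

lemma writes_test_prog: "writes (test_prog k) \<subseteq> {2, 3, 4, 9, 10} \<union> {20..<20 + 2 * k}"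
  by (induction k) auto

lemma not_writes_test_prog [simp]:
  "a < 20 \<Longrightarrow> a \<notin> {2, 3, 4, 9, 10} \<Longrightarrow> a \<notin> writes (test_prog k)"
  "20 + 2 * k \<le> a \<Longrightarrow> a \<notin> writes (test_prog k)"
  using writes_test_prog[of k] by auto

lemma wf_test_prog: "1 \<le> K \<Longrightarrow> wf_prog K (test_prog k)"
  by (induction k) (simp_all add: reach_prog_def reset_prog_def round_prog_def)

lemma writes_repeat_prog: "writes (repeat_prog q P) \<subseteq> writes P"
  by (induction q) auto

lemma wf_repeat_prog: "wf_prog K P \<Longrightarrow> wf_prog K (repeat_prog q P)"
  by (induction q) auto

lemma not_writes_lower_prog:
  "a < 20 \<Longrightarrow> a \<notin> {2, 3, 4, 8, 9, 10} \<Longrightarrow> a \<notin> writes (lower_prog k)"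
  by (simp add: lower_prog_def)

lemma not_writes_minimize_prog:
  "a < 20 \<Longrightarrow> a \<notin> {2, 3, 4, 8, 9, 10, 11} \<Longrightarrow> a \<notin> writes (minimize_prog p k)"
  using writes_repeat_prog[of p "lower_prog k"] not_writes_lower_prog[of a k]
  by (auto simp: minimize_prog_def)

lemma not_writes_candidate_prog:
  "a < 20 \<Longrightarrow> a \<notin> {1, 2, 3, 4, 5, 6, 7, 8, 9, 10, 11} \<Longrightarrow> a \<notin> writes (candidate_prog p i j)"
  using not_writes_minimize_prog[of a p "i - 1"]
  by (simp add: candidate_prog_def setup_prog_def output_prog_def)

lemma wf_candidate_prog:
  assumes "i \<in> {1..p}"
  shows "wf_prog p (candidate_prog p i j)"
proof -
  have "11 \<notin> writes (repeat_prog p (lower_prog (i - 1)))"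
    using writes_repeat_prog[of p "lower_prog (i - 1)"] not_writes_lower_prog[of 11 "i - 1"] by auto
  with assms show ?thesis
    by (auto simp: candidate_prog_def setup_prog_def output_prog_def minimize_prog_def lower_prog_def
        intro!: wf_test_prog wf_repeat_prog)
qed

lemma wf_main_prog: "wf_prog p (main_prog p)"
proof -
  have *: "wf_prog p (foldr (\<lambda>(i, j) P. LFor 12 (candidate_prog p i j) ;; P) ijs LSkip)"
    if "set ijs \<subseteq> {1..p} \<times> {1..p}" for ijs
    using that
    by (induction ijs) (auto simp: wf_candidate_prog not_writes_candidate_prog)
  show ?thesis unfolding main_prog_def by (rule *) auto
qed

section \<open>The layout of the input\<close>

lemma nth_concat_triples:
  assumes "j < length xs" "k < 3" "\<And>x. length (f x) = 3"
  shows "concat (map f xs) ! (3 * j + k) = f (xs ! j) ! k"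
  using assms
proof (induction xs arbitrary: j)
  case (Cons x xs)
  then show ?case by (cases j) (simp_all add: nth_append)
qed simp

locale network_input = network N for N :: "nat flow_network" +
  fixes vs :: "nat list" and es :: "(nat \<times> nat) list"
  assumes lists: "lists_network N vs es"
begin

abbreviation "n \<equiv> length es"
abbreviation "input \<equiv> input_memory (encode_network N vs es) 0"

lemma set_es: "set es = A" and distinct_es: "distinct es"
  using lists by (auto simp: lists_network_def)

lemma es_nth_in_A: "j < n \<Longrightarrow> es ! j \<in> A"
  using set_es nth_mem by blast

lemma length_encode: "length (encode_network N vs es) = 4 + length vs + 3 * n"
  by (simp add: encode_network_def length_concat o_def case_prod_beta sum_list_triv)

lemma input_simps [simp]: "input 0 = s" "input (Suc 0) = t" "input 2 = length vs"
  by (simp_all add: input_memory_def length_encode) (simp_all add: encode_network_def)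

lemma input_arc_count: "input (3 + length vs) = n"
  by (simp add: input_memory_def length_encode) (simp add: encode_network_def nth_append)

lemma input_arc_field:
  assumes "j < n" "k < 3"
  shows "input (4 + k + length vs + 3 * j) = [fst (es ! j), snd (es ! j), net_cap N (es ! j)] ! k"
proof -
  let ?f = "\<lambda>(u, v). [u, v, net_cap N (u, v)]"
  have "4 + k + length vs + 3 * j < length (encode_network N vs es)"
    using assms by (simp add: length_encode)
  then have "input (4 + k + length vs + 3 * j) = encode_network N vs es ! (4 + k + length vs + 3 * j)"
    by (simp add: input_memory_def)
  also have "\<dots> = concat (map ?f es) ! (3 * j + k)"
    by (simp add: encode_network_def nth_append nth_Cons' add.commute)
  also have "\<dots> = ?f (es ! j) ! k"
    using assms by (intro nth_concat_triples) (auto simp: case_prod_beta)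
  finally show ?thesis by (simp add: case_prod_beta)
qed

lemma eval_arc_field:
  assumes "m 0 = input" "eval_expr e m < n"
  shows "eval_expr (arc_tail e) m = fst (es ! eval_expr e m)"
    "eval_expr (arc_head e) m = snd (es ! eval_expr e m)"
    "eval_expr (arc_cap e) m = net_cap N (es ! eval_expr e m)"
  using input_arc_field[OF assms(2), of 0] input_arc_field[OF assms(2), of 1]
    input_arc_field[OF assms(2), of 2] assms(1)
  by (simp_all add: arc_field_def)

definition caps_in :: "memory \<Rightarrow> (nat \<times> nat \<Rightarrow> nat) \<Rightarrow> bool" where
  "caps_in m w \<longleftrightarrow> (\<forall>j<n. m 2 j = w (es ! j))"

lemma caps_in_store:
  assumes "caps_in m w" "j < n"
  shows "caps_in (store 2 j x m) (w(es ! j := x))"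
  using assms distinct_es by (auto simp: caps_in_def nth_eq_iff_index_eq)

text \<open>All vertices that a search can mark or ask about. Only their marks are reset; array 3
  may hold anything elsewhere.\<close>

definition relevant :: "nat set" where
  "relevant = {s, t} \<union> fst ` set es \<union> snd ` set es"

section \<open>Correctness of the search and of the packing test\<close>

lemma reset_prog_spec:
  assumes "m 0 = input" "v \<in> relevant"
  shows "sem reset_prog n m 3 v = of_bool (v = s)"
proof -
  let ?P = "LAssign 3 (arc_tail (var 9)) (Const 0) ;; LAssign 3 (arc_head (var 9)) (Const 0)"
  define m1 where "m1 = sem (LFor 9 ?P) n m"
  let ?I = "\<lambda>i m. m 0 = input \<and> (\<forall>j<i. m 3 (fst (es ! j)) = 0 \<and> m 3 (snd (es ! j)) = 0)"
  have "?I n m1"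
    unfolding m1_def
  proof (rule sem_LFor[where I = ?I])
    fix i and m :: memory assume "i < n" "?I i m" "m 9 0 = i"
    then show "?I (Suc i) (next_index 9 (sem ?P n m))"
      by (simp add: eval_arc_field less_Suc_eq del: One_nat_def)
  qed (use assms(1) in simp_all)
  then have "m1 0 = input" "m1 3 v = 0 \<or> v = s \<or> v = t"
    using assms(2) by (fastforce simp: relevant_def in_set_conv_nth)+
  then show ?thesis
    unfolding reset_prog_def sem.simps(3) m1_def[symmetric] by auto
qed

text \<open>Which vertices a round marks depends on the order of the arcs. It is enough to know that
  it takes at least every single step and never leaves the transitive closure.\<close>

lemma round_prog_spec:
  assumes "m 0 = input" "caps_in m w"
  shows "\<forall>v. (sem round_prog n m 3 v \<noteq> 0 \<longrightarrow> m 3 v \<noteq> 0 \<or> (\<exists>u. m 3 u \<noteq> 0 \<and> (u, v) \<in> (support N w)\<^sup>+)) \<and>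
      (m 3 v \<noteq> 0 \<longrightarrow> sem round_prog n m 3 v \<noteq> 0)"
    and "\<forall>u v. m 3 u \<noteq> 0 \<longrightarrow> (u, v) \<in> support N w \<longrightarrow> sem round_prog n m 3 v \<noteq> 0"
proof -
  let ?P = "LCond (Times (Cell 3 (arc_tail (var 9))) (Cell 2 (var 9)))
    (LAssign 3 (arc_head (var 9)) (Const 1)) LSkip"
  let ?I = "\<lambda>i m'. m' 0 = input \<and> m' 2 = m 2 \<and>
    (\<forall>v. (m' 3 v \<noteq> 0 \<longrightarrow> m 3 v \<noteq> 0 \<or> (\<exists>u. m 3 u \<noteq> 0 \<and> (u, v) \<in> (support N w)\<^sup>+)) \<and>
      (m 3 v \<noteq> 0 \<longrightarrow> m' 3 v \<noteq> 0)) \<and>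
    (\<forall>j<i. m 3 (fst (es ! j)) \<noteq> 0 \<longrightarrow> w (es ! j) \<noteq> 0 \<longrightarrow> m' 3 (snd (es ! j)) \<noteq> 0)"
  have I: "?I n (sem round_prog n m)"
    unfolding round_prog_def
  proof (rule sem_LFor[where I = ?I])
    fix i and m' :: memory assume i: "i < n" "?I i m'" "m' 9 0 = i"
    have w: "m 2 i = w (es ! i)" using assms(2) i(1) by (simp add: caps_in_def)
    let ?u = "fst (es ! i)" and ?v = "snd (es ! i)"
    have ev: "eval_expr (arc_tail (var 9)) m' = ?u" "eval_expr (arc_head (var 9)) m' = ?v"
      using i by (simp_all add: eval_arc_field)
    show "?I (Suc i) (next_index 9 (sem ?P n m'))"
    proof (cases "m' 3 ?u \<noteq> 0 \<and> w (es ! i) \<noteq> 0")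
      case True
      then have "(?u, ?v) \<in> support N w" using i(1) es_nth_in_A by (simp add: support_def)
      with True i(2) have "\<exists>u. m 3 u \<noteq> 0 \<and> (u, ?v) \<in> (support N w)\<^sup>+"
        by (meson r_into_trancl trancl_into_trancl)
      moreover have "sem ?P n m' = store 3 ?v 1 m'" using True w i by (simp add: ev)
      ultimately show ?thesis using i by (auto simp: less_Suc_eq)
    next
      case False
      then have "sem ?P n m' = m'" using w i by (auto simp: ev)
      moreover have "m 3 ?u \<noteq> 0 \<longrightarrow> w (es ! i) \<noteq> 0 \<longrightarrow> m' 3 ?v \<noteq> 0" using False i(2) by blast
      ultimately show ?thesis using i by (simp add: less_Suc_eq)
    qed
  qed (use assms in simp_all)
  then show "\<forall>v. (sem round_prog n m 3 v \<noteq> 0 \<longrightarrow> m 3 v \<noteq> 0 \<or> (\<exists>u. m 3 u \<noteq> 0 \<and> (u, v) \<in> (support N w)\<^sup>+)) \<and>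
      (m 3 v \<noteq> 0 \<longrightarrow> sem round_prog n m 3 v \<noteq> 0)" by blast
  show "\<forall>u v. m 3 u \<noteq> 0 \<longrightarrow> (u, v) \<in> support N w \<longrightarrow> sem round_prog n m 3 v \<noteq> 0"
  proof (intro allI impI)
    fix u v assume u: "m 3 u \<noteq> 0" and uv: "(u, v) \<in> support N w"
    then have "(u, v) \<in> set es" "w (u, v) \<noteq> 0" using set_es by (simp_all add: support_def)
    then obtain j where "j < n" "es ! j = (u, v)" by (auto simp: in_set_conv_nth)
    with I u \<open>w (u, v) \<noteq> 0\<close> show "sem round_prog n m 3 v \<noteq> 0" by (metis fst_conv snd_conv)
  qed
qed


lemma reach_prog_spec:
  assumes "m 0 = input" "caps_in m w"
  shows "sem reach_prog n m 4 0 = (if feas N 0 w then m 4 0 else 0)"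
proof -
  let ?R = "support N w"
  define m1 where "m1 = sem reset_prog n m"
  have m1: "m1 0 = input" "m1 2 = m 2" "m1 4 = m 4"
    unfolding m1_def using assms(1) by (auto simp: sem_frame reset_prog_def)
  have marks: "m1 3 v = of_bool (v = s)" if "v \<in> relevant" for v
    unfolding m1_def using assms(1) that by (rule reset_prog_spec)
  have rel: "u \<in> relevant" "v \<in> relevant" if "(u, v) \<in> ?R" for u v
    using that set_es by (force simp: support_def relevant_def)+
  define m2 where "m2 = sem (LFor 10 round_prog) n m1"
  let ?I = "\<lambda>i m'. m' 0 = input \<and> m' 2 = m 2 \<and> m' 4 = m 4 \<and>
    (\<forall>v\<in>relevant. (m' 3 v \<noteq> 0 \<longrightarrow> (s, v) \<in> ?R\<^sup>*) \<and> (\<forall>k\<le>i. (s, v) \<in> ?R ^^ k \<longrightarrow> m' 3 v \<noteq> 0))"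
  have I: "?I n m2"
    unfolding m2_def
  proof (rule sem_LFor[where I = ?I])
    show "10 \<notin> writes round_prog" by (simp add: round_prog_def)
    show "?I 0 (store 10 0 0 m1)" using m1 marks by simp
    fix i and m' :: memory assume I: "?I i m'"
    define m'' where "m'' = sem round_prog n m'"
    have "caps_in m' w" using I assms(2) by (simp add: caps_in_def)
    then have spec: "(m'' 3 v \<noteq> 0 \<longrightarrow> m' 3 v \<noteq> 0 \<or> (\<exists>u. m' 3 u \<noteq> 0 \<and> (u, v) \<in> ?R\<^sup>+)) \<and> (m' 3 v \<noteq> 0 \<longrightarrow> m'' 3 v \<noteq> 0)"
      and step: "m' 3 u \<noteq> 0 \<Longrightarrow> (u, v) \<in> ?R \<Longrightarrow> m'' 3 v \<noteq> 0" for u v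
      using round_prog_spec[of m' w] I unfolding m''_def by blast+
    have "m'' 0 = input" "m'' 2 = m 2" "m'' 4 = m 4"
      using I unfolding m''_def by (auto simp: sem_frame round_prog_def)
    moreover have "(s, v) \<in> ?R\<^sup>*" if v: "v \<in> relevant" "m'' 3 v \<noteq> 0" for v
    proof (cases "m' 3 v \<noteq> 0")
      case True
      with I v(1) show ?thesis by blast
    next
      case False
      then obtain u where u: "m' 3 u \<noteq> 0" "(u, v) \<in> ?R\<^sup>+" using spec[of v] v(2) by blast
      then have "u \<in> relevant" by (meson rel(1) tranclD)
      with I u show ?thesis by (meson rtrancl_trans trancl_into_rtrancl)
    qed
    moreover have "m'' 3 v \<noteq> 0" if v: "v \<in> relevant" "k \<le> Suc i" "(s, v) \<in> ?R ^^ k" for v k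
    proof (cases "k \<le> i")
      case True
      with I v have "m' 3 v \<noteq> 0" by blast
      with spec[of v] show ?thesis by blast
    next
      case False
      with v(2) have "k = Suc i" by simp
      with v(3) obtain u where u: "(s, u) \<in> ?R ^^ i" "(u, v) \<in> ?R" by auto
      then have "m' 3 u \<noteq> 0" using I rel(1) by blast
      with u(2) step show ?thesis by blast
    qed
    ultimately show "?I (Suc i) (next_index 10 (sem round_prog n m'))"
      unfolding m''_def[symmetric] by simp
  qed
  have "?R\<^sup>* = (\<Union>k\<in>{k. k \<le> card ?R}. ?R ^^ k)"
    by (rule rtrancl_finite_eq_relpow) (use finite_A in \<open>simp add: support_def\<close>)
  moreover have "card ?R \<le> n"
    using card_mono[OF finite_A, of ?R] set_es distinct_card[OF distinct_es] by (auto simp: support_def)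
  ultimately have "(s, t) \<in> ?R\<^sup>* \<longrightarrow> (\<exists>k\<le>n. (s, t) \<in> ?R ^^ k)"
    by (metis (mono_tags, lifting) UN_E le_trans mem_Collect_eq)
  moreover have "t \<in> relevant" by (simp add: relevant_def)
  ultimately have "m2 3 t \<noteq> 0 \<longleftrightarrow> (s, t) \<in> ?R\<^sup>*" using I by blast
  then show ?thesis
    using I by (auto simp: reach_prog_def simp flip: m1_def m2_def)
qed

lemma sem_test_prog_frame:
  "a < 20 \<Longrightarrow> a \<notin> {2, 3, 4, 9, 10} \<Longrightarrow> sem (test_prog k) n m a = m a"
  by (simp add: sem_frame)

lemma test_prog_spec:
  assumes "m 0 = input" "caps_in m w"
  shows "sem (test_prog k) n m 4 0 = (if feas N k w then m 4 0 else 0)"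
    and "sem (test_prog k) n m 2 = m 2"
proof -
  have "sem (test_prog k) n m 4 0 = (if feas N k w then m 4 0 else 0) \<and> sem (test_prog k) n m 2 = m 2"
    using assms
  proof (induction k arbitrary: m w)
    case 0
    then show ?case by (simp add: reach_prog_spec sem_frame del: feas.simps)
  next
    case (Suc k)
    let ?v = "20 + 2 * k" and ?x = "21 + 2 * k"
    let ?P = "LAssign ?x (Const 0) (Cell 2 (var ?v)) ;;
      LAssign 2 (var ?v) (Monus (Cell 2 (var ?v)) (Const 1)) ;;
      test_prog k ;; LAssign 2 (var ?v) (var ?x)"
    define F where "F j \<longleftrightarrow> feas N k (w(es ! j := w (es ! j) - 1))" for j
    \<comment> \<open>Array 2 is restored exactly, so the removals at different arcs all start from
      the same capacities.\<close>
    let ?I = "\<lambda>i m'. m' 0 = input \<and> m' 2 = m 2 \<and> m' 4 0 = (if \<forall>j<i. F j then m 4 0 else 0)"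
    have "?I n (sem (test_prog (Suc k)) n m)"
      unfolding test_prog.simps
    proof (rule sem_LFor[where I = ?I])
      show "?v \<notin> writes ?P" by simp
      show "?I 0 (store ?v 0 0 m)" using Suc.prems by simp
      fix i and m' :: memory assume i: "i < n" and I: "?I i m'" and v: "m' ?v 0 = i"
      define m1 where "m1 = store 2 i (m 2 i - 1) (store ?x 0 (m 2 i) m')"
      define m2 where "m2 = sem (test_prog k) n m1"
      have "caps_in (store ?x 0 (m 2 i) m') w" using I Suc.prems(2) by (simp add: caps_in_def)
      then have "caps_in m1 (w(es ! i := m 2 i - 1))"
        unfolding m1_def using i by (rule caps_in_store)
      moreover have "m 2 i = w (es ! i)" using Suc.prems(2) i by (simp add: caps_in_def)
      moreover have "m1 0 = input" using I by (simp add: m1_def)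
      ultimately have m2: "m2 4 0 = (if F i then m1 4 0 else 0)" "m2 2 = m1 2"
        unfolding m2_def F_def using Suc.IH[of m1] by simp_all
      have m2': "m2 0 = input" "m2 ?v 0 = i" "m2 ?x 0 = m 2 i"
        unfolding m2_def using I v by (simp_all add: sem_frame m1_def)
      have "sem ?P n m' = store 2 i (m 2 i) m2"
        using I v m2' by (simp add: m2_def m1_def)
      moreover have "store 2 i (m 2 i) m2 2 = m 2"
        using m2(2) I by (simp add: m1_def)
      ultimately have "sem ?P n m' 0 = input" "sem ?P n m' 2 = m 2" "sem ?P n m' 4 0 = m2 4 0"
        using m2'(1) by (simp_all del: sem.simps)
      moreover have "m1 4 0 = m' 4 0" by (simp add: m1_def)
      moreover have "(\<forall>j<Suc i. F j) \<longleftrightarrow> (\<forall>j<i. F j) \<and> F i" by (auto simp: less_Suc_eq)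
      ultimately show "?I (Suc i) (next_index ?v (sem ?P n m'))"
        using I m2(1) by (auto simp del: sem.simps)
    qed
    moreover have "(\<forall>j<n. F j) \<longleftrightarrow> feas N (Suc k) w"
      unfolding F_def feas.simps set_es[symmetric] all_set_conv_all_nth ..
    ultimately show ?case by simp
  qed
  then show "sem (test_prog k) n m 4 0 = (if feas N k w then m 4 0 else 0)"
    "sem (test_prog k) n m 2 = m 2" by auto
qed

lemma setup_prog_spec:
  assumes "m 0 = input"
  shows "caps_in (sem (setup_prog p) n m) (rate_caps p (m 7 0))"
proof -
  let ?P = "LAssign 2 (var 9) (Monus (Div (arc_cap (var 9)) (var 7))
    (Monus (Div (arc_cap (var 9)) (var 7)) (Const p)))"
  let ?I = "\<lambda>i m'. m' 0 = input \<and> m' 7 = m 7 \<and> (\<forall>j<i. m' 2 j = rate_caps p (m 7 0) (es ! j))"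
  have "?I n (sem (setup_prog p) n m)"
    unfolding setup_prog_def
  proof (rule sem_LFor[where I = ?I])
    fix i and m' :: memory assume "i < n" "?I i m'" "m' 9 0 = i"
    then show "?I (Suc i) (next_index 9 (sem ?P n m'))"
      by (auto simp: eval_arc_field rate_caps_def less_Suc_eq)
  qed (use assms in simp_all)
  then show ?thesis by (simp add: caps_in_def)
qed

lemma output_prog_spec:
  assumes "m 0 = input" "caps_in m w" "j < n"
  shows "sem output_prog n m 1 j = min (net_cap N (es ! j)) (m 7 0 * w (es ! j))"
proof -
  let ?P = "LAssign 1 (var 9)
    (Monus (arc_cap (var 9)) (Monus (arc_cap (var 9)) (Times (var 7) (Cell 2 (var 9)))))"
  let ?I = "\<lambda>i m'. m' 0 = input \<and> m' 7 = m 7 \<and> m' 2 = m 2 \<and>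
    (\<forall>j<i. m' 1 j = min (net_cap N (es ! j)) (m 7 0 * w (es ! j)))"
  have "?I n (sem output_prog n m)"
    unfolding output_prog_def
  proof (rule sem_LFor[where I = ?I])
    fix i and m' :: memory assume i: "i < n" "?I i m'" "m' 9 0 = i"
    have "m 2 i = w (es ! i)" using assms(2) i(1) by (simp add: caps_in_def)
    with i show "?I (Suc i) (next_index 9 (sem ?P n m'))"
      by (auto simp: eval_arc_field less_Suc_eq)
  qed (use assms in simp_all)
  with assms(3) show ?thesis by simp
qed

section \<open>Minimal capacities\<close>

definition irreducible_at :: "nat \<Rightarrow> (nat \<times> nat \<Rightarrow> nat) \<Rightarrow> nat \<times> nat \<Rightarrow> bool" where
  "irreducible_at k w a \<longleftrightarrow> w a = 0 \<or> \<not> feas N k (w(a := w a - 1))"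

lemma lower_prog_spec:
  assumes "m 0 = input" "caps_in m w" "m 11 0 = i" "i < n"
  defines "w' \<equiv> w(es ! i := w (es ! i) - 1)"
  shows "caps_in (sem (lower_prog k) n m) (if feas N k w' then w' else w)"
proof -
  define m1 where "m1 = store 4 0 1 (store 2 i (m 2 i - 1) (store 8 0 (m 2 i) m))"
  define m2 where "m2 = sem (test_prog k) n m1"
  have "caps_in (store 8 0 (m 2 i) m) w" using assms(2) by (simp add: caps_in_def)
  then have "caps_in (store 2 i (m 2 i - 1) (store 8 0 (m 2 i) m)) (w(es ! i := m 2 i - 1))"
    using assms(4) by (rule caps_in_store)
  moreover have w_i: "m 2 i = w (es ! i)" using assms by (simp add: caps_in_def)
  ultimately have m1: "caps_in m1 w'" "m1 0 = input"
    using assms(1) by (simp_all add: caps_in_def m1_def w'_def)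
  have m2: "m2 4 0 = (if feas N k w' then 1 else 0)" "m2 2 = m1 2"
    using test_prog_spec[OF m1(2,1)] by (simp_all add: m2_def m1_def)
  have m2': "m2 11 0 = i" "m2 8 0 = m 2 i"
    using assms(3) by (simp_all add: m2_def m1_def sem_test_prog_frame)
  have "sem (lower_prog k) n m = (if feas N k w' then m2 else store 2 i (m 2 i) m2)"
    using assms(3) m2(1) m2' by (simp add: lower_prog_def m2_def m1_def)
  moreover have "caps_in m2 w'" using m1(1) m2(2) by (simp add: caps_in_def)
  moreover from caps_in_store[OF this assms(4), of "m 2 i"]
  have "caps_in (store 2 i (m 2 i) m2) w" by (simp add: w'_def w_i)
  ultimately show ?thesis by simp
qed

text \<open>An attempt lowers the capacity of the arc unless it is irreducible there, and then
  nothing changes any more. So the last hypothesis, with \<open>q\<close> attempts left, is the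
  invariant of a countdown.\<close>

lemma repeat_lower_prog_spec:
  assumes "m 0 = input" "caps_in m w" "m 11 0 = i" "i < n" "feas N k w"
    "w (es ! i) \<le> q \<or> irreducible_at k w (es ! i)"
  shows "\<exists>w'. caps_in (sem (repeat_prog q (lower_prog k)) n m) w' \<and> feas N k w' \<and>
    (\<forall>a. w' a \<le> w a) \<and> irreducible_at k w' (es ! i)"
  using assms
proof (induction q arbitrary: m w)
  case 0
  then show ?case by (auto simp: irreducible_at_def)
next
  case (Suc q)
  let ?w = "w(es ! i := w (es ! i) - 1)"
  define w1 where "w1 = (if feas N k ?w then ?w else w)"
  have m1: "sem (lower_prog k) n m 0 = input" "sem (lower_prog k) n m 11 0 = i"
    using Suc.prems by (simp_all add: sem_frame not_writes_lower_prog)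
  have "caps_in (sem (lower_prog k) n m) w1"
    unfolding w1_def using Suc.prems by (intro lower_prog_spec)
  moreover have "feas N k w1" using Suc.prems(5) by (simp add: w1_def)
  moreover have "w1 (es ! i) \<le> q \<or> irreducible_at k w1 (es ! i)"
    using Suc.prems(6) by (auto simp: w1_def irreducible_at_def)
  ultimately obtain w' where w': "caps_in (sem (repeat_prog q (lower_prog k)) n (sem (lower_prog k) n m)) w'"
    "feas N k w'" "\<forall>a. w' a \<le> w1 a" "irreducible_at k w' (es ! i)"
    using Suc.IH[OF m1(1) _ m1(2) Suc.prems(4)] by blast
  have "w1 a \<le> w a" for a by (simp add: w1_def)
  with w'(3) have "\<forall>a. w' a \<le> w a" using le_trans by blast
  with w' show ?case by auto
qed

text \<open>Smaller capacities pack no more paths, so a decrement that was impossible stays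
  impossible when other arcs are lowered.\<close>

lemma irreducible_at_mono:
  assumes "irreducible_at k w a" "\<And>a. w' a \<le> w a" "a \<in> A"
  shows "irreducible_at k w' a"
proof -
  have "A \<noteq> {}" using assms(3) by blast
  note packs = feas_iff_packs[OF this]
  have "(w'(a := w' a - 1)) b \<le> (w(a := w a - 1)) b" for b
    using assms(2) by (simp add: diff_le_mono)
  then have "feas N k (w'(a := w' a - 1)) \<Longrightarrow> feas N k (w(a := w a - 1))"
    unfolding packs using packs_mono by blast
  moreover have "w a = 0 \<Longrightarrow> w' a = 0" using assms(2)[of a] by simp
  ultimately show ?thesis using assms(1) by (auto simp: irreducible_at_def)
qed

lemma minimize_prog_spec:
  assumes "m 0 = input" "caps_in m w" "feas N k w" "\<And>a. w a \<le> p"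
  shows "\<exists>w'. caps_in (sem (minimize_prog p k) n m) w' \<and> feas N k w' \<and> (\<forall>a. w' a \<le> w a) \<and>
    (\<forall>a\<in>A. irreducible_at k w' a)"
proof -
  let ?P = "repeat_prog p (lower_prog k)"
  let ?I = "\<lambda>i m'. m' 0 = input \<and> (\<exists>w'. caps_in m' w' \<and> feas N k w' \<and> (\<forall>a. w' a \<le> w a) \<and>
    (\<forall>j<i. irreducible_at k w' (es ! j)))"
  have "?I n (sem (minimize_prog p k) n m)"
    unfolding minimize_prog_def
  proof (rule sem_LFor[where I = ?I])
    show "11 \<notin> writes ?P"
      using writes_repeat_prog[of p "lower_prog k"] not_writes_lower_prog[of 11 k] by auto
    show "?I 0 (store 11 0 0 m)" using assms by (auto simp: caps_in_def)
    fix i and m' :: memory assume i: "i < n" and I: "?I i m'" and v: "m' 11 0 = i"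
    then obtain w1 where w1: "caps_in m' w1" "feas N k w1" "\<forall>a. w1 a \<le> w a"
      "\<forall>j<i. irreducible_at k w1 (es ! j)" by blast
    have "w1 (es ! i) \<le> p" using w1(3) assms(4) le_trans by blast
    then obtain w' where w': "caps_in (sem ?P n m') w'" "feas N k w'" "\<forall>a. w' a \<le> w1 a"
      "irreducible_at k w' (es ! i)"
      using repeat_lower_prog_spec[OF _ w1(1) v i w1(2)] I by blast
    have "irreducible_at k w' (es ! j)" if "j < Suc i" for j
    proof (cases "j = i")
      case False
      with that w1(4) have "irreducible_at k w1 (es ! j)" by simp
      moreover have "es ! j \<in> A" using es_nth_in_A that i by simp
      ultimately show ?thesis by (metis irreducible_at_mono w'(3))
    qed (simp add: w'(4))
    moreover have "\<forall>a. w' a \<le> w a" using w'(3) w1(3) le_trans by blast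
    moreover have "0 \<notin> writes ?P"
      using writes_repeat_prog[of p "lower_prog k"] not_writes_lower_prog[of 0 k] by auto
    then have "sem ?P n m' 0 = input" using I by (simp add: sem_frame)
    moreover have "caps_in (next_index 11 (sem ?P n m')) w'" using w'(1) by (simp add: caps_in_def)
    ultimately show "?I (Suc i) (next_index 11 (sem ?P n m'))" using w'(2) by auto
  qed
  then show ?thesis using set_es by (metis in_set_conv_nth)
qed

section \<open>Maintaining the best solution\<close>

definition best :: "memory \<Rightarrow> nat" where
  "best m = m 5 0 * m 6 0"

definition solution_in :: "nat \<Rightarrow> memory \<Rightarrow> bool" where
  "solution_in p m \<longleftrightarrow> (\<exists>x. outputs_flow m es x \<and> is_flow N x \<and> decomposable p N x \<and>
     flow_value N x = int (best m))"

lemma minimize_output_spec: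
  assumes m: "m 0 = input" "caps_in m (rate_caps p r)" "m 7 0 = r" "0 < r" "A \<noteq> {}"
    "feas N k (rate_caps p r)" "Suc k \<le> p" "m 5 0 = Suc k" "m 6 0 = r"
  shows "solution_in p (sem (minimize_prog p k ;; output_prog) n m)"
    "best (sem (minimize_prog p k ;; output_prog) n m) = Suc k * r"
proof -
  define m1 where "m1 = sem (minimize_prog p k) n m"
  let ?m = "sem output_prog n m1"
  have "rate_caps p r a \<le> p" for a by (simp add: rate_caps_def)
  then obtain w where w: "caps_in m1 w" "feas N k w" "\<forall>a. w a \<le> rate_caps p r a"
    "\<forall>a\<in>A. irreducible_at k w a"
    using minimize_prog_spec[OF m(1,2,6)] unfolding m1_def by blast
  have m1: "m1 0 = input" "m1 7 0 = r" "m1 5 0 = Suc k" "m1 6 0 = r"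
    using m by (simp_all add: m1_def sem_frame not_writes_minimize_prog)
  then show best: "best (sem (minimize_prog p k ;; output_prog) n m) = Suc k * r"
    by (simp add: best_def sem_frame output_prog_def flip: m1_def)
  note packs = feas_iff_packs[OF m(5)]
  obtain Ps where Ps: "length Ps = Suc k" "\<And>P. P \<in> set Ps \<Longrightarrow> st_path N P" "\<And>a. a \<in> A \<Longrightarrow> load Ps a = w a"
    using packs_minimal[of "Suc k" w] w(2,4) unfolding packs irreducible_at_def by blast
  have cap: "r * load Ps a \<le> net_cap N a" if "a \<in> A" for a
  proof -
    have "load Ps a \<le> net_cap N a div r" using spec[OF w(3), of a] Ps(3)[OF that] by (simp add: rate_caps_def)
    then have "r * load Ps a \<le> r * (net_cap N a div r)" by (rule mult_le_mono2)
    also have "\<dots> \<le> net_cap N a" by simp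
    finally show ?thesis .
  qed
  define x where "x a = int (r * load Ps a)" for a
  have "outputs_flow ?m es x"
    unfolding outputs_flow_def
  proof (intro allI impI)
    fix j assume j: "j < n"
    have "?m 1 j = min (net_cap N (es ! j)) (r * w (es ! j))"
      using output_prog_spec[OF m1(1) w(1) j] m1(2) by simp
    also have "\<dots> = r * load Ps (es ! j)"
      using cap[OF es_nth_in_A[OF j]] Ps(3)[OF es_nth_in_A[OF j]] by simp
    finally show "x (es ! j) = int (?m 1 j)" by (simp add: x_def)
  qed
  moreover have "is_flow N x" "decomposable p N x" "flow_value N x = int (length Ps * r)"
    using flow_of_equal_paths[OF Ps(2) _ cap, of p x] Ps(1) m(7) by (simp_all add: x_def)
  ultimately show "solution_in p (sem (minimize_prog p k ;; output_prog) n m)"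
    unfolding solution_in_def best using Ps(1) by (auto simp flip: m1_def)
qed

lemma solution_in_cong:
  assumes "m' 1 = m 1" "m' 5 = m 5" "m' 6 = m 6"
  shows "solution_in p m' = solution_in p m" "best m' = best m"
  using assms by (simp_all add: solution_in_def best_def outputs_flow_def)

lemma candidate_prog_spec:
  fixes j :: nat
  assumes m: "m 0 = input" "solution_in p m" "m 12 0 = l" "l < n" and i: "i \<in> {1..p}"
  defines "r \<equiv> net_cap N (es ! l) div j" and "m' \<equiv> sem (candidate_prog p i j) n m"
  shows "solution_in p m'" "best m \<le> best m'"
    "packs N i (rate_caps p r) \<Longrightarrow> i * r \<le> best m'"
proof -
  have "A \<noteq> {}" using es_nth_in_A[OF m(4)] by blast
  have packs: "feas N (i - 1) w \<longleftrightarrow> packs N i w" for w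
    using feas_iff_packs[OF \<open>A \<noteq> {}\<close>, of "i - 1" w] i by simp
  define m1 where "m1 = store 7 0 r m"
  define m2 where "m2 = store 4 0 1 (sem (setup_prog p) n m1)"
  define m3 where "m3 = sem (test_prog (i - 1)) n m2"
  have m2: "caps_in m2 (rate_caps p r)"
    using setup_prog_spec[of m1 p] m(1) by (simp add: m2_def m1_def caps_in_def)
  have m1: "m1 7 0 = r" "a \<noteq> 7 \<Longrightarrow> m1 a = m a" for a by (simp_all add: m1_def)
  have setup_frame: "sem (setup_prog p) n m1 a = m1 a" if "a \<notin> {2, 9}" for a
    using that by (intro sem_frame) (simp add: setup_prog_def)
  have m2_0: "m2 0 = input" using m(1) by (simp add: m2_def m1 setup_frame)
  have m3: "caps_in m3 (rate_caps p r)"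
    "m3 4 0 = (if packs N i (rate_caps p r) then 1 else 0)"
    using test_prog_spec[OF m2_0 m2, of "i - 1"] m2
    unfolding m3_def packs by (simp_all add: caps_in_def m2_def)
  have m3': "m3 0 = input" "m3 7 0 = r" "m3 5 = m 5" "m3 6 = m 6" "m3 1 = m 1"
    using m(1) by (simp_all add: m3_def m2_def m1 sem_test_prog_frame setup_frame)
  define better where "better \<longleftrightarrow> packs N i (rate_caps p r) \<and> best m < i * r"
  let ?m = "store 6 0 r (store 5 0 i m3)"
  have r: "eval_expr (Div (arc_cap (var 12)) (Const j)) m = r"
    using m by (simp add: r_def eval_arc_field)
  have m'_eq: "m' = (if better then sem (minimize_prog p (i - 1) ;; output_prog) n ?m else m3)"
    using r m3(2) m3' unfolding m'_def candidate_prog_def better_def best_def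
    by (simp add: m1_def m2_def m3_def)
  have old: "solution_in p m3" "best m3 = best m"
    using solution_in_cong[of m3 m] m3' m(2) by auto
  have new: "solution_in p m'" "best m' = i * r" if better
  proof -
    \<comment> \<open>Beating \<open>best m\<close> forces \<open>i * r\<close>, and with it
      \<open>r\<close>, to be positive.\<close>
    have "0 < r" "Suc (i - 1) = i" using that i by (auto simp: better_def intro: gr0I)
    moreover have "caps_in ?m (rate_caps p r)" using m3(1) by (simp add: caps_in_def)
    moreover have "feas N (i - 1) (rate_caps p r)" using that packs by (simp add: better_def)
    ultimately show "solution_in p m'" "best m' = i * r"
      using minimize_output_spec[of ?m p r "i - 1"] m3' i that \<open>A \<noteq> {}\<close>
      unfolding m'_eq by (simp_all del: sem.simps)
  qed
  show "solution_in p m'" using old new m'_eq by (cases better) simp_all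
  show "best m \<le> best m'"
    using old new m'_eq by (cases better) (auto simp: better_def)
  show "i * r \<le> best m'" if "packs N i (rate_caps p r)"
    using old new m'_eq that by (cases better) (auto simp: better_def)
qed

lemma for_candidate_spec:
  fixes j :: nat
  assumes m: "m 0 = input" "solution_in p m" and i: "i \<in> {1..p}"
  defines "m' \<equiv> sem (LFor 12 (candidate_prog p i j)) n m"
  shows "m' 0 = input" "solution_in p m'" "best m \<le> best m'"
    "\<And>a. a \<in> A \<Longrightarrow> packs N i (rate_caps p (net_cap N a div j)) \<Longrightarrow> i * (net_cap N a div j) \<le> best m'"
proof -
  let ?r = "\<lambda>l. net_cap N (es ! l) div j"
  let ?I = "\<lambda>l m'. m' 0 = input \<and> solution_in p m' \<and> best m \<le> best m' \<and>
    (\<forall>j<l. packs N i (rate_caps p (?r j)) \<longrightarrow> i * ?r j \<le> best m')"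
  have "?I n m'"
    unfolding m'_def
  proof (rule sem_LFor[where I = ?I])
    show "12 \<notin> writes (candidate_prog p i j)" by (simp add: not_writes_candidate_prog)
    show "?I 0 (store 12 0 0 m)" using m solution_in_cong[of "store 12 0 0 m" m] by simp
    fix l and m' :: memory assume l: "l < n" and I: "?I l m'" and v: "m' 12 0 = l"
    let ?m = "sem (candidate_prog p i j) n m'"
    have "solution_in p ?m" "best m' \<le> best ?m" "packs N i (rate_caps p (?r l)) \<Longrightarrow> i * ?r l \<le> best ?m"
      using candidate_prog_spec[where m = m' and l = l and i = i and j = j and p = p] I v l i by simp_all
    moreover have "?m 0 = input" using I by (simp add: sem_frame not_writes_candidate_prog)
    ultimately show "?I (Suc l) (next_index 12 ?m)"
      using I solution_in_cong[of "next_index 12 ?m" ?m] by (auto simp: less_Suc_eq intro: le_trans)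
  qed
  then show "m' 0 = input" "solution_in p m'" "best m \<le> best m'"
    and "\<And>a. a \<in> A \<Longrightarrow> packs N i (rate_caps p (net_cap N a div j)) \<Longrightarrow> i * (net_cap N a div j) \<le> best m'"
    using set_es by (metis in_set_conv_nth)+
qed

lemma main_prog_spec:
  assumes m: "m 0 = input" "solution_in p m"
  defines "m' \<equiv> sem (main_prog p) n m"
  shows "solution_in p m'"
    "\<And>i j a. i \<in> {1..p} \<Longrightarrow> j \<in> {1..p} \<Longrightarrow> a \<in> A \<Longrightarrow>
      packs N i (rate_caps p (net_cap N a div j)) \<Longrightarrow> i * (net_cap N a div j) \<le> best m'"
proof -
  let ?P = "\<lambda>ijs. foldr (\<lambda>(i, j) P. LFor 12 (candidate_prog p i j) ;; P) ijs LSkip"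
  have *: "solution_in p (sem (?P ijs) n m) \<and> best m \<le> best (sem (?P ijs) n m) \<and>
      (\<forall>(i, j)\<in>set ijs. \<forall>a\<in>A. packs N i (rate_caps p (net_cap N a div j)) \<longrightarrow>
        i * (net_cap N a div j) \<le> best (sem (?P ijs) n m))"
    if "set ijs \<subseteq> {1..p} \<times> {1..p}" for ijs
    using that m
  proof (induction ijs arbitrary: m)
    case (Cons ij ijs)
    obtain i j where ij: "ij = (i, j)" by (cases ij)
    let ?m = "sem (LFor 12 (candidate_prog p i j)) n m"
    have i: "i \<in> {1..p}" using Cons.prems(1) ij by auto
    note spec = for_candidate_spec[OF Cons.prems(2,3) i, where j = j]
    let ?B = "best (sem (?P ijs) n ?m)"
    have "set ijs \<subseteq> {1..p} \<times> {1..p}" using Cons.prems(1) by simp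
    note IH = Cons.IH[OF this spec(1,2)]
    have "best ?m \<le> ?B" using IH by blast
    then have "best m \<le> ?B"
      and "\<forall>a\<in>A. packs N i (rate_caps p (net_cap N a div j)) \<longrightarrow> i * (net_cap N a div j) \<le> ?B"
      using spec(3,4) le_trans by blast+
    moreover have "sem (?P (ij # ijs)) n m = sem (?P ijs) n ?m" by (simp only: ij) simp
    ultimately show ?case using IH by (simp only: list.set ball_simps ij prod.case) blast
  qed simp
  have pairs: "set (List.product [1..<Suc p] [1..<Suc p]) = {1..p} \<times> {1..p}" by auto
  show "solution_in p m'"
    using *[of "List.product [1..<Suc p] [1..<Suc p]"] unfolding m'_def main_prog_def pairs by blast
  show "i * (net_cap N a div j) \<le> best m'"
    if "i \<in> {1..p}" "j \<in> {1..p}" "a \<in> A" "packs N i (rate_caps p (net_cap N a div j))" for i j a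
    using *[of "List.product [1..<Suc p] [1..<Suc p]"] that unfolding m'_def main_prog_def pairs by blast
qed

text \<open>Cells outside the input are 0 and thus represent the zero flow. It remains the output if
  no candidate of positive value can be packed, and also if there are no arcs, when no loop body
  runs.\<close>

lemma solution_in_input: "solution_in p (input_memory (encode_network N vs es))"
proof -
  have "is_flow N (\<lambda>_. 0)" "decomposable p N (\<lambda>_. 0)" "flow_value N (\<lambda>_. 0) = 0"
    by (auto simp: is_flow_def net_out_def decomposable_def flow_value_def intro: exI[of _ "[]"])
  then show ?thesis
    unfolding solution_in_def
    by (intro exI[of _ "\<lambda>_. 0"]) (simp add: best_def outputs_flow_def input_memory_def)
qed

lemma encode_network_nth:
  "2 < length (encode_network N vs es)" "3 + encode_network N vs es ! 2 < length (encode_network N vs es)"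
  "n = encode_network N vs es ! (3 + encode_network N vs es ! 2)" "n \<le> length (encode_network N vs es)"
  using input_arc_count by (simp_all add: length_encode input_memory_def) (simp_all add: encode_network_def)

end

theorem theorem6p3:
  fixes p :: nat
  assumes "p \<ge> 1"
  shows "\<exists>(P :: program) (q :: nat poly).
    \<forall>(N :: nat flow_network) vs as.
      flow_network N \<longrightarrow> lists_network N vs as \<longrightarrow>
      (\<exists>T m x.
         exec P (input_memory (encode_network N vs as)) T m \<and>
         T \<le> poly q (input_size (encode_network N vs as)) \<and>
         outputs_flow m as x \<and>
         is_flow N x \<and> decomposable p N x \<and>
         real_of_int (flow_value N x) \<ge> 1 / harm p * real_of_int (max_decomposable_value p N))"
proof -
  obtain q where q: "\<forall>xs n. 2 < length xs \<longrightarrow> 3 + xs ! 2 < length xs \<longrightarrow> n = xs ! (3 + xs ! 2) \<longrightarrow> n \<le> length xs \<longrightarrow>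
    (\<exists>T\<le>poly q (input_size xs). exec (compile (main_prog p)) (input_memory xs) T (sem (main_prog p) n (input_memory xs)))"
    using exec_compile_poly[OF wf_main_prog] by blast
  show ?thesis
  proof (intro exI[of _ "compile (main_prog p)"] exI[of _ q] allI impI)
    fix N :: "nat flow_network" and vs es assume "flow_network N" "lists_network N vs es"
    then interpret network_input N vs es by unfold_locales
    let ?xs = "encode_network N vs es"
    let ?m = "sem (main_prog p) n (input_memory ?xs)"
    obtain T where T: "T \<le> poly q (input_size ?xs)" "exec (compile (main_prog p)) (input_memory ?xs) T ?m"
      using q encode_network_nth by blast
    note spec = main_prog_spec[where p = p, OF refl solution_in_input]
    obtain x where x: "outputs_flow ?m es x" "is_flow N x" "decomposable p N x"
      "flow_value N x = int (best ?m)"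
      using spec(1) by (auto simp: solution_in_def)
    have "real_of_int (max_decomposable_value p N) \<le> real (best ?m) * harm p"
      using spec(2) by (rule max_le_harm)
    moreover have "(0::real) < harm p" using assms by (intro harm_pos) simp
    ultimately have "1 / harm p * real_of_int (max_decomposable_value p N) \<le> real_of_int (flow_value N x)"
      by (simp add: x(4) field_simps)
    with T x show "\<exists>T m x. exec (compile (main_prog p)) (input_memory ?xs) T m \<and>
         T \<le> poly q (input_size ?xs) \<and> outputs_flow m es x \<and> is_flow N x \<and> decomposable p N x \<and>
         1 / harm p * real_of_int (max_decomposable_value p N) \<le> real_of_int (flow_value N x)"
      by blast
  qed
qed

end
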